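(* The Yokonuma-Hecke algebra $\mathcal{Y}_{r,n}(q)$ is isomorphic (as an $R$-algebra) to the modified Ariki-Koike algebra $\mathcal{H}_{r,n}(q)$.
   Context: Let $n,r\ge 1$ be integers, $\xi=e^{2\pi i/r}\in\mathbb{C}$, $q$ an indeterminate and $R=\mathbb{Z}[q,q^{-1},\xi,r^{-1},\Delta_0^{-1}]$ with $\Delta_0=\prod_{0\le i<j\le r-1}(\xi^i-\xi^j)$. The symmetric group $\mathfrak{S}_n$ acts on the right on $\{1,\dots,n\}$ and $s_i=(i,i+1)$. The Yokonuma-Hecke algebra $\mathcal{Y}_{r,n}(q)$ is the associative unital $R$-algebra generated by $g_1,\dots,g_{n-1},t_1,\dots,t_n$ with relations: $t_i^r=1$; $t_it_j=t_jt_i$; $t_jg_i=g_it_{js_i}$ for all $i,j$; $g_ig_j=g_jg_i$ for $|i-j|>1$; $g_ig_{i+1}g_i=g_{i+1}g_ig_{i+1}$; and $g_i^2=1+(q-q^{-1})e_ig_i$, where $e_i=\frac1r\sum_{s=0}^{r-1}t_i^st_{i+1}^{-s}$. Let $\mathbf{A}$ be the $r\times r$ matrix with entries $\mathbf{A}_{ij}=\xi^{j(i-1)}$, $1\le i,j\le r$, let $\Delta=\prod_{1\le j<i\le r}(\xi^i-\xi^j)$ (its determinant), write $\mathbf{A}^{-1}=\Delta^{-1}(h_{ij})$, and set $F_i(X)=\sum_{j=1}^r h_{ij}X^{j-1}\in\mathbb{Z}[\xi][X]$ for $1\le i\le r$. The modified Ariki-Koike algebra $\mathcal{H}_{r,n}(q)$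 is the associative unital $R$-algebra generated by $h_2,\dots,h_n,\omega_1,\dots,\omega_n$ with relations: - $(h_i-q)(h_i+q^{-1})=0$ for all $i$; - $h_ih_j=h_jh_i$ for $|i-j|>1$; $h_ih_{i+1}h_i=h_{i+1}h_ih_{i+1}$ for $2\le i\le n-1$; - $(\omega_i-\xi^1)\cdots(\omega_i-\xi^r)=0$ for all $i$; $\omega_i\omega_j=\omega_j\omega_i$ for all $i,j$; - $h_j\omega_j=\omega_{j-1}h_j+\Delta^{-2}\sum_{c_1<c_2}(\xi^{c_2}-\xi^{c_1})(q-q^{-1})F_{c_1}(\omega_{j-1})F_{c_2}(\omega_j)$; - $h_j\omega_{j-1}=\omega_jh_j-\Delta^{-2}\sum_{c_1<c_2}(\xi^{c_2}-\xi^{c_1})(q-q^{-1})F_{c_1}(\omega_{j-1})F_{c_2}(\omega_j)$; - $h_j\omega_l=\omega_lh_j$ for $l\ne j,j-1$; where the sums run over $1\le c_1<c_2\le r$. *)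

theory Defs
  imports
    "HOL-Algebra.Algebraic_Closure_Type"
    "HOL-Algebra.Generated_Rings"
    "HOL-Algebra.QuotRing"
    "HOL-Library.Poly_Mapping"
    "HOL-Computational_Algebra.Polynomial_Factorial"
    "HOL-Combinatorics.Transposition"
    "Jordan_Normal_Form.Gauss_Jordan_Elimination"
begin

section \<open>Associative algebras given by generators and relations\<close>

text \<open>
  The free monoid, written additively, so that \<open>'g word \<Rightarrow>\<^sub>0 'k\<close> with the convolution product
  of \<^theory>\<open>HOL-Library.Poly_Mapping\<close> is the free associative unital \<open>'k\<close>-algebra on \<open>'g\<close>.
\<close>

datatype 'g word = Word (letters: "'g list")

instantiation word :: (type) monoid_add
begin

definition zero_word :: "'a word" where
  "zero_word = Word []"

definition plus_word :: "'a word \<Rightarrow> 'a word \<Rightarrow> 'a word" where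
  "plus_word v w = Word (letters v @ letters w)"

instance
  by standard (simp_all add: zero_word_def plus_word_def)

end

definition gen :: "'g \<Rightarrow> 'g word \<Rightarrow>\<^sub>0 'k::ring_1" where
  "gen x = Poly_Mapping.single (Word [x]) 1"

definition const :: "'k::ring_1 \<Rightarrow> 'g word \<Rightarrow>\<^sub>0 'k" where
  "const c = Poly_Mapping.single 0 c"

text \<open>
  The free associative unital \<open>S\<close>-algebra on the generating set \<open>G\<close>, for a subring \<open>S\<close> of \<open>'k\<close>.
\<close>

definition free_algebra :: "'k::ring_1 set \<Rightarrow> 'g set \<Rightarrow> ('k, 'g word \<Rightarrow>\<^sub>0 'k) module" where
  "free_algebra S G =
     \<lparr>carrier = {f. \<forall>w\<in>Poly_Mapping.keys f. Poly_Mapping.lookup f w \<in> S \<and> set (letters w) \<subseteq> G},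
      monoid.mult = (*), one = 1, zero = 0, add = (+), module.smult = (\<lambda>c f. const c * f)\<rparr>"

text \<open>
  Quotient of an algebra by a two-sided ideal; the scalar action follows the pattern of
  \<^const>\<open>rcoset_mult\<close>.
\<close>

definition quotient_algebra ::
    "('k, 'a) module \<Rightarrow> 'a set \<Rightarrow> ('k, 'a set) module" where
  "quotient_algebra A I =
     \<lparr>carrier = carrier (A Quot I), monoid.mult = monoid.mult (A Quot I), one = one (A Quot I),
      zero = zero (A Quot I), add = add (A Quot I),
      module.smult = (\<lambda>c C. \<Union>a\<in>C. I +>\<^bsub>A\<^esub> (c \<odot>\<^bsub>A\<^esub> a))\<rparr>"

text \<open>
  A pair \<open>(u, v)\<close> in \<open>Rel\<close> stands for the relation \<open>u = v\<close>. The predicate \<^const>\<open>ideal\<close> means two-sided ideal,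
  so \<^const>\<open>genideal\<close> is the generated two-sided ideal.
\<close>

definition presented_algebra ::
    "'k::ring_1 set \<Rightarrow> 'g set \<Rightarrow> (('g word \<Rightarrow>\<^sub>0 'k) \<times> ('g word \<Rightarrow>\<^sub>0 'k)) set
      \<Rightarrow> ('k, ('g word \<Rightarrow>\<^sub>0 'k) set) module" where
  "presented_algebra S G Rel =
     quotient_algebra (free_algebra S G)
       (Idl\<^bsub>free_algebra S G\<^esub> ((\<lambda>(u, v). u - v) ` Rel))"

text \<open>
  The locale \<^locale>\<open>algebra\<close> covers commutative algebras only, hence the following definition.
\<close>

definition algebra_iso ::
    "('k, 'm) ring_scheme \<Rightarrow> ('k, 'a) module \<Rightarrow> ('k, 'b) module \<Rightarrow> ('a \<Rightarrow> 'b) set" where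
  "algebra_iso R A B =
     {\<phi> \<in> ring_iso A B. \<forall>c\<in>carrier R. \<forall>x\<in>carrier A. \<phi> (c \<odot>\<^bsub>A\<^esub> x) = c \<odot>\<^bsub>B\<^esub> \<phi> x}"

definition algebra_isomorphic ::
    "('k, 'm) ring_scheme \<Rightarrow> ('k, 'a) module \<Rightarrow> ('k, 'b) module \<Rightarrow> bool" where
  "algebra_isomorphic R A B \<longleftrightarrow> algebra_iso R A B \<noteq> {}"


section \<open>The coefficient ring\<close>

text \<open>
  The ring \<open>\<int>[q, q\<^sup>-\<^sup>1, \<xi>, r\<^sup>-\<^sup>1, \<Delta>\<^sub>0\<^sup>-\<^sup>1]\<close> is realised as a subring of the field
  \<open>\<complex>(q)\<close> of rational functions, i.e. of the type \<^typ>\<open>complex poly fract\<close>.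
\<close>

definition xi :: "nat \<Rightarrow> complex" where
  "xi r = exp (2 * of_real pi * \<i> / of_nat r)"

definition Delta0 :: "nat \<Rightarrow> complex" where
  "Delta0 r = (\<Prod>j<r. \<Prod>i<j. xi r ^ i - xi r ^ j)"

definition Delta :: "nat \<Rightarrow> complex" where
  "Delta r = (\<Prod>i=1..r. \<Prod>j=1..<i. xi r ^ i - xi r ^ j)"

definition of_complex :: "complex \<Rightarrow> complex poly fract" where
  "of_complex c = to_fract [:c:]"

definition qvar :: "complex poly fract" where
  "qvar = to_fract [:0, 1:]"

definition coeff_ring :: "nat \<Rightarrow> complex poly fract ring" where
  "coeff_ring r = ring_of_type_algebra
     \<lparr>carrier := generate_ring ring_of_type_algebra
        {qvar, inverse qvar, of_complex (xi r), of_complex (inverse (of_nat r)),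
         of_complex (inverse (Delta0 r))}\<rparr>"

abbreviation cst :: "complex \<Rightarrow> 'g word \<Rightarrow>\<^sub>0 complex poly fract" where
  "cst c \<equiv> const (of_complex c)"


section \<open>The Yokonuma-Hecke algebra\<close>

datatype yh_generator = Gen_g nat | Gen_t nat

type_synonym yh_free = "yh_generator word \<Rightarrow>\<^sub>0 complex poly fract"

abbreviation yg :: "nat \<Rightarrow> yh_free" where "yg i \<equiv> gen (Gen_g i)"
abbreviation yt :: "nat \<Rightarrow> yh_free" where "yt i \<equiv> gen (Gen_t i)"

definition yh_generators :: "nat \<Rightarrow> yh_generator set" where
  "yh_generators n = Gen_g ` {1..<n} \<union> Gen_t ` {1..n}"

text \<open>
  The \<open>t\<^sub>i\<close> are not invertible in the free algebra; as \<open>t\<^sub>i\<^sup>r = 1\<close> in the quotient,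
  \<open>t\<^sub>i\<^sup>-\<^sup>s\<close> is represented by \<open>t\<^sub>i\<^sup>r\<^sup>-\<^sup>s\<close> for \<open>0 \<le> s < r\<close>.
\<close>

definition ye :: "nat \<Rightarrow> nat \<Rightarrow> yh_free" where
  "ye r i = cst (inverse (of_nat r)) * (\<Sum>s<r. yt i ^ s * yt (i + 1) ^ (r - s))"

definition yh_relations :: "nat \<Rightarrow> nat \<Rightarrow> (yh_free \<times> yh_free) set" where
  "yh_relations r n =
     {(yt i ^ r, 1) | i. i \<in> {1..n}}
   \<union> {(yt i * yt j, yt j * yt i) | i j. i \<in> {1..n} \<and> j \<in> {1..n}}
   \<union> {(yt j * yg i, yg i * yt (transpose i (i + 1) j)) | i j. i \<in> {1..<n} \<and> j \<in> {1..n}}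
   \<union> {(yg i * yg j, yg j * yg i) | i j. i \<in> {1..<n} \<and> j \<in> {1..<n} \<and> \<bar>int i - int j\<bar> > 1}
   \<union> {(yg i * yg (i + 1) * yg i, yg (i + 1) * yg i * yg (i + 1)) | i. i \<in> {1..<n} \<and> i + 1 \<in> {1..<n}}
   \<union> {(yg i ^ 2, 1 + const (qvar - inverse qvar) * ye r i * yg i) | i. i \<in> {1..<n}}"

definition yokonuma_hecke ::
    "nat \<Rightarrow> nat \<Rightarrow> (complex poly fract, yh_free set) module" where
  "yokonuma_hecke r n =
     presented_algebra (carrier (coeff_ring r)) (yh_generators n) (yh_relations r n)"


section \<open>The modified Ariki-Koike algebra\<close>

datatype ak_generator = Gen_h nat | Gen_omega nat

type_synonym ak_free = "ak_generator word \<Rightarrow>\<^sub>0 complex poly fract"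

abbreviation akh :: "nat \<Rightarrow> ak_free" where "akh i \<equiv> gen (Gen_h i)"
abbreviation ako :: "nat \<Rightarrow> ak_free" where "ako i \<equiv> gen (Gen_omega i)"

definition ak_generators :: "nat \<Rightarrow> ak_generator set" where
  "ak_generators n = Gen_h ` {2..n} \<union> Gen_omega ` {1..n}"

text \<open>
  Rows and columns of \<^typ>\<open>complex mat\<close> are indexed from 0: the mathematical entry at \<open>(i, j)\<close>
  sits at \<open>(i - 1, j - 1)\<close>.
\<close>

definition A_mat :: "nat \<Rightarrow> complex mat" where
  "A_mat r = mat r r (\<lambda>(i, j). xi r ^ ((j + 1) * i))"

definition h_coeff :: "nat \<Rightarrow> nat \<Rightarrow> nat \<Rightarrow> complex" where
  "h_coeff r i j = Delta r * the (mat_inverse (A_mat r)) $$ (i - 1, j - 1)"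

text \<open>\<open>F_eval r i x\<close> is the value of the polynomial \<open>F\<^sub>i\<close> at the element \<open>x\<close> of the free algebra.\<close>

definition F_eval :: "nat \<Rightarrow> nat \<Rightarrow> ak_free \<Rightarrow> ak_free" where
  "F_eval r i x = (\<Sum>j=1..r. cst (h_coeff r i j) * x ^ (j - 1))"

definition ak_correction :: "nat \<Rightarrow> nat \<Rightarrow> ak_free" where
  "ak_correction r j =
     cst (inverse (Delta r ^ 2)) *
       (\<Sum>c\<^sub>2=1..r. \<Sum>c\<^sub>1=1..<c\<^sub>2.
          cst (xi r ^ c\<^sub>2 - xi r ^ c\<^sub>1) * const (qvar - inverse qvar) * F_eval r c\<^sub>1 (ako (j - 1)) * F_eval r c\<^sub>2 (ako j))"

text \<open>The product over \<open>k\<close> is a list product because the free algebra is not commutative.\<close>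

definition ak_relations :: "nat \<Rightarrow> nat \<Rightarrow> (ak_free \<times> ak_free) set" where
  "ak_relations r n =
     {((akh i - const qvar) * (akh i + const (inverse qvar)), 0) | i. i \<in> {2..n}}
   \<union> {(akh i * akh j, akh j * akh i) | i j. i \<in> {2..n} \<and> j \<in> {2..n} \<and> \<bar>int i - int j\<bar> > 1}
   \<union> {(akh i * akh (i + 1) * akh i, akh (i + 1) * akh i * akh (i + 1)) | i. 2 \<le> i \<and> i + 1 \<le> n}
   \<union> {(\<Prod>k\<leftarrow>[1..<r + 1]. ako i - cst (xi r ^ k), 0) | i. i \<in> {1..n}}
   \<union> {(ako i * ako j, ako j * ako i) | i j. i \<in> {1..n} \<and> j \<in> {1..n}}
   \<union> {(akh j * ako j, ako (j - 1) * akh j + ak_correction r j) | j. j \<in> {2..n}}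
   \<union> {(akh j * ako (j - 1), ako j * akh j - ak_correction r j) | j. j \<in> {2..n}}
   \<union> {(akh j * ako l, ako l * akh j) | j l. j \<in> {2..n} \<and> l \<in> {1..n} \<and> l \<noteq> j \<and> l \<noteq> j - 1}"

definition modified_ariki_koike ::
    "nat \<Rightarrow> nat \<Rightarrow> (complex poly fract, ak_free set) module" where
  "modified_ariki_koike r n =
     presented_algebra (carrier (coeff_ring r)) (ak_generators n) (ak_relations r n)"

end

theory Submission
  imports Defs "Jordan_Normal_Form.Determinant"
begin

text \<open>
  The polynomials \<open>F\<^sub>c / \<Delta>\<close> are the Lagrange interpolation polynomials at the \<open>r\<close>-th roots of unity, so
  \<open>P\<^sub>c(x) = F\<^sub>c(x) / \<Delta>\<close> is the projection onto the \<open>\<xi>\<^sup>c\<close>-eigenspace of an element \<open>x\<close> with \<open>x\<^sup>r = 1\<close>. Put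
  \<open>T\<^sub>a\<^sub>b = \<Sum>\<^sub>c\<^sub><\<^sub>d P\<^sub>c(t\<^sub>a) P\<^sub>d(t\<^sub>b)\<close>. The substitution \<open>\<omega>\<^sub>i = t\<^sub>i\<close>, \<open>h\<^sub>i\<^sub>+\<^sub>1 = g\<^sub>i + (q - q\<^sup>-\<^sup>1) T\<^sub>i\<^sub>,\<^sub>i\<^sub>+\<^sub>1\<close> is an isomorphism
  of free algebras, with inverse \<open>g\<^sub>i = h\<^sub>i\<^sub>+\<^sub>1 - (q - q\<^sup>-\<^sup>1) T\<^sub>i\<^sub>,\<^sub>i\<^sub>+\<^sub>1\<close>, and it matches the two ideals of relations:
  conjugation by \<open>g\<^sub>i\<close> permutes the \<open>T\<^sub>a\<^sub>b\<close>, and \<open>e\<^sub>i + T\<^sub>i\<^sub>,\<^sub>i\<^sub>+\<^sub>1 + T\<^sub>i\<^sub>+\<^sub>1\<^sub>,\<^sub>i = 1\<close>, so that each relation for the \<open>h\<^sub>i\<close>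
  differs from the corresponding relation for the \<open>g\<^sub>i\<close> by an identity between commuting projections.
\<close>


section \<open>Scalars, monomials and induction over monomials in the free algebra\<close>

lemma const_0 [simp]: "const 0 = 0"
  and const_1 [simp]: "const 1 = 1"
  and const_add: "const (a + b) = const a + const b"
  and const_uminus: "const (- a) = - const a"
  and const_diff: "const (a - b) = const a - const b"
  and const_mult: "const (a * b) = const a * const b"
  by (simp_all add: const_def single_add single_uminus single_diff mult_single)

lemma const_sum: "const (\<Sum>x\<in>A. f x) = (\<Sum>x\<in>A. const (f x))"
  by (induction A rule: infinite_finite_induct) (simp_all add: const_add)

lemma poly_mapping_eq_sum_single:
  fixes f :: "'a \<Rightarrow>\<^sub>0 'b::comm_monoid_add"
  shows "f = (\<Sum>w\<in>Poly_Mapping.keys f. Poly_Mapping.single w (Poly_Mapping.lookup f w))"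
  by (rule poly_mapping_eqI)
     (simp add: lookup_sum lookup_single when_def in_keys_iff sum.delta')

text \<open>The single case concerns only words in the support of \<open>f\<close>, with their own
  coefficients, so conditions on the letters and coefficients of \<open>f\<close> remain available
  there.\<close>

lemma poly_mapping_sum_induct [case_names zero single add]:
  fixes f :: "'a \<Rightarrow>\<^sub>0 'b::comm_monoid_add"
  assumes "P 0"
    and "\<And>w. w \<in> Poly_Mapping.keys f \<Longrightarrow> P (Poly_Mapping.single w (Poly_Mapping.lookup f w))"
    and "\<And>g h. P g \<Longrightarrow> P h \<Longrightarrow> P (g + h)"
  shows "P f"
proof -
  have "P (\<Sum>w\<in>A. Poly_Mapping.single w (Poly_Mapping.lookup f w))" if "A \<subseteq> Poly_Mapping.keys f" "finite A" for A
    using that(2,1) by (induction A rule: finite_induct) (auto intro: assms)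
  then show ?thesis
    using poly_mapping_eq_sum_single[of f] finite_keys[of f] by fastforce
qed

lemma const_commute: "const (c :: 'k::comm_ring_1) * f = f * const c"
  by (induction f rule: poly_mapping_sum_induct)
     (simp_all add: const_def mult_single mult.commute distrib_left distrib_right)

lemma const_left_commute: "f * (const (c :: 'k::comm_ring_1) * g) = const c * (f * g)"
  by (metis const_commute mult.assoc)

lemma single_eq_const_mult_gens:
  fixes c :: "'k::ring_1"
  shows "Poly_Mapping.single w c = const c * prod_list (map gen (letters w))"
proof -
  have "prod_list (map gen xs) = Poly_Mapping.single (Word xs) (1::'k)" for xs :: "'a list"
    by (induction xs) (simp_all add: gen_def mult_single plus_word_def zero_word_def flip: single_one)
  then show ?thesis
    by (simp add: const_def mult_single)
qed


section \<open>Substitution homomorphisms\<close>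

text \<open>The homomorphism supplied by the universal property of the free algebra.\<close>

definition subst :: "('g \<Rightarrow> 'h word \<Rightarrow>\<^sub>0 'k) \<Rightarrow> ('g word \<Rightarrow>\<^sub>0 'k) \<Rightarrow> 'h word \<Rightarrow>\<^sub>0 'k::comm_ring_1" where
  "subst \<sigma> f = (\<Sum>w\<in>Poly_Mapping.keys f. const (Poly_Mapping.lookup f w) * prod_list (map \<sigma> (letters w)))"

text \<open>Enlarging the index set lets the sums for \<open>f\<close>, \<open>g\<close> and
  \<open>f + g\<close> run over one common set.\<close>

lemma subst_eq_sum:
  assumes "finite A" "Poly_Mapping.keys f \<subseteq> A"
  shows "subst \<sigma> f = (\<Sum>w\<in>A. const (Poly_Mapping.lookup f w) * prod_list (map \<sigma> (letters w)))"
  unfolding subst_def using assms by (intro sum.mono_neutral_left) (auto simp: in_keys_iff)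

lemma subst_0 [simp]: "subst \<sigma> 0 = 0"
  by (simp add: subst_def)

lemma subst_add: "subst \<sigma> (f + g) = subst \<sigma> f + subst \<sigma> g"
proof -
  let ?A = "Poly_Mapping.keys f \<union> Poly_Mapping.keys g"
  show ?thesis
    using keys_add[of f g]
    by (simp add: subst_eq_sum[of ?A] lookup_add const_add distrib_right sum.distrib)
qed

lemma subst_single: "subst \<sigma> (Poly_Mapping.single w c) = const c * prod_list (map \<sigma> (letters w))"
  by (subst subst_eq_sum[of "{w}"]) (auto split: if_splits)

lemma subst_uminus: "subst \<sigma> (- f) = - subst \<sigma> f"
  using subst_add[of \<sigma> f "- f"] by (simp add: eq_neg_iff_add_eq_0 add.commute)

lemma subst_diff: "subst \<sigma> (f - g) = subst \<sigma> f - subst \<sigma> g"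
  using subst_add[of \<sigma> f "- g"] by (simp add: subst_uminus)

lemma subst_sum: "subst \<sigma> (\<Sum>x\<in>A. f x) = (\<Sum>x\<in>A. subst \<sigma> (f x))"
  by (induction A rule: infinite_finite_induct) (simp_all add: subst_add)

text \<open>Biadditivity reduces this to monomials, where words are concatenated and the inner
  scalar moves out by centrality.\<close>

lemma subst_mult: "subst \<sigma> (f * g) = subst \<sigma> f * subst \<sigma> g"
proof (induction f rule: poly_mapping_sum_induct)
  case (single v)
  show ?case
  proof (induction g rule: poly_mapping_sum_induct)
    case (single w)
    show ?case
      by (simp add: mult_single subst_single plus_word_def const_mult mult.assoc
            const_left_commute[of "prod_list (map \<sigma> (letters v))"])
  qed (simp_all add: subst_add distrib_left)
qed (simp_all add: subst_add distrib_right)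

lemma subst_const [simp]: "subst \<sigma> (const c) = const c"
  unfolding const_def subst_single by (simp add: zero_word_def)

lemma subst_1 [simp]: "subst \<sigma> 1 = 1"
  using subst_const[of \<sigma> 1] by simp

lemma subst_gen [simp]: "subst \<sigma> (gen x) = \<sigma> x"
  by (simp add: gen_def subst_single)

lemma subst_power: "subst \<sigma> (f ^ k) = subst \<sigma> f ^ k"
  by (induction k) (simp_all add: subst_mult)

lemma subst_prod_list: "subst \<sigma> (prod_list fs) = prod_list (map (subst \<sigma>) fs)"
  by (induction fs) (simp_all add: subst_mult)

lemmas subst_simps = subst_add subst_uminus subst_diff subst_sum subst_mult subst_power subst_prod_list


section \<open>Free algebras over a subring\<close>

lemma free_algebra_ops:
  "monoid.mult (free_algebra S G) = (*)" "one (free_algebra S G) = 1" "zero (free_algebra S G) = 0"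
  "add (free_algebra S G) = (+)" "module.smult (free_algebra S G) = (\<lambda>c f. const c * f)"
  by (simp_all add: free_algebra_def)

locale scalar_subring =
  fixes S :: "'k::comm_ring_1 set"
  assumes subring: "subring S ring_of_type_algebra"
begin

lemma scalar_closed:
  "0 \<in> S" "1 \<in> S" "a \<in> S \<Longrightarrow> - a \<in> S" "a \<in> S \<Longrightarrow> b \<in> S \<Longrightarrow> a + b \<in> S"
  "a \<in> S \<Longrightarrow> b \<in> S \<Longrightarrow> a * b \<in> S" "a \<in> S \<Longrightarrow> b \<in> S \<Longrightarrow> a - b \<in> S"
proof -
  interpret K: ring "ring_of_type_algebra :: 'k ring"
    by (rule ring_from_type_algebra)
  have "\<ominus>\<^bsub>ring_of_type_algebra\<^esub> a = - a" for a :: 'k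
    by (rule K.minus_equality) (simp_all add: ring_of_type_algebra_def)
  then show "0 \<in> S" "1 \<in> S" and u: "\<And>a. a \<in> S \<Longrightarrow> - a \<in> S"
    and p: "\<And>a b. a \<in> S \<Longrightarrow> b \<in> S \<Longrightarrow> a + b \<in> S" and "a \<in> S \<Longrightarrow> b \<in> S \<Longrightarrow> a * b \<in> S"
    using subringE[OF subring] by (auto simp: ring_of_type_algebra_def)
  show "a \<in> S \<Longrightarrow> b \<in> S \<Longrightarrow> a - b \<in> S"
    using p[OF _ u, of a b] by simp
qed

lemma scalar_power: "a \<in> S \<Longrightarrow> a ^ k \<in> S"
  by (induction k) (auto intro: scalar_closed)

abbreviation free_carrier :: "'g set \<Rightarrow> ('g word \<Rightarrow>\<^sub>0 'k) set" where
  "free_carrier G \<equiv> carrier (free_algebra S G)"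

lemma free_carrier_iff:
  "f \<in> free_carrier G \<longleftrightarrow>
    (\<forall>w\<in>Poly_Mapping.keys f. Poly_Mapping.lookup f w \<in> S \<and> set (letters w) \<subseteq> G)"
  by (simp add: free_algebra_def)

lemma free_carrier_lookup: "f \<in> free_carrier G \<Longrightarrow> Poly_Mapping.lookup f w \<in> S"
  by (cases "w \<in> Poly_Mapping.keys f") (auto simp: free_carrier_iff in_keys_iff scalar_closed)

lemma single_closed: "c \<in> S \<Longrightarrow> set (letters w) \<subseteq> G \<Longrightarrow> Poly_Mapping.single w c \<in> free_carrier G"
  by (simp add: free_carrier_iff)

lemma const_closed: "c \<in> S \<Longrightarrow> const c \<in> free_carrier G"
  unfolding const_def by (rule single_closed) (simp_all add: zero_word_def)

lemma gen_closed: "x \<in> G \<Longrightarrow> gen x \<in> free_carrier G"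
  unfolding gen_def by (rule single_closed) (simp_all add: scalar_closed)

lemma zero_closed: "0 \<in> free_carrier G"
  by (simp add: free_carrier_iff)

lemma one_closed: "1 \<in> free_carrier G"
  using const_closed[of 1 G] by (simp add: scalar_closed)

lemma add_closed: "f \<in> free_carrier G \<Longrightarrow> g \<in> free_carrier G \<Longrightarrow> f + g \<in> free_carrier G"
  using keys_add[of f g]
  by (auto simp: free_carrier_iff[of "f + g"] lookup_add intro!: scalar_closed free_carrier_lookup)
     (auto simp: free_carrier_iff)

lemma uminus_closed: "f \<in> free_carrier G \<Longrightarrow> - f \<in> free_carrier G"
  by (auto simp: free_carrier_iff in_keys_iff intro: scalar_closed)

lemma diff_closed: "f \<in> free_carrier G \<Longrightarrow> g \<in> free_carrier G \<Longrightarrow> f - g \<in> free_carrier G"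
  using add_closed[OF _ uminus_closed, of f G g] by simp

lemma sum_closed: "(\<And>x. x \<in> A \<Longrightarrow> f x \<in> free_carrier G) \<Longrightarrow> (\<Sum>x\<in>A. f x) \<in> free_carrier G"
  by (induction A rule: infinite_finite_induct) (auto intro: add_closed zero_closed)

lemma mult_closed:
  assumes "f \<in> free_carrier G" "g \<in> free_carrier G"
  shows "f * g \<in> free_carrier G"
proof (induction f rule: poly_mapping_sum_induct)
  case (single v)
  show ?case
  proof (induction g rule: poly_mapping_sum_induct)
    case (single w)
    with \<open>v \<in> _\<close> assms show ?case
      by (auto simp: mult_single plus_word_def free_carrier_iff
               intro!: single_closed scalar_closed)
  qed (simp_all add: add_closed zero_closed distrib_left)
qed (simp_all add: add_closed zero_closed distrib_right)

lemma power_closed: "f \<in> free_carrier G \<Longrightarrow> f ^ k \<in> free_carrier G"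
  by (induction k) (auto intro: one_closed mult_closed)

lemma prod_list_closed: "set fs \<subseteq> free_carrier G \<Longrightarrow> prod_list fs \<in> free_carrier G"
  by (induction fs) (auto intro: one_closed mult_closed)

lemma ring_free_algebra: "ring (free_algebra S G)"
proof (rule ringI)
  show "abelian_group (free_algebra S G)"
  proof (rule abelian_groupI)
    fix f assume "f \<in> free_carrier G"
    then show "\<exists>g\<in>free_carrier G. g \<oplus>\<^bsub>free_algebra S G\<^esub> f = \<zero>\<^bsub>free_algebra S G\<^esub>"
      by (intro bexI[of _ "- f"] uminus_closed) (simp_all add: free_algebra_ops)
  qed (simp_all add: free_algebra_ops add_ac add_closed zero_closed)
  show "Group.monoid (free_algebra S G)"
    by (rule monoidI) (simp_all add: free_algebra_ops mult.assoc mult_closed one_closed)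
qed (simp_all add: free_algebra_ops distrib_left distrib_right)

lemma subst_closed:
  assumes "f \<in> free_carrier G" "\<And>x. x \<in> G \<Longrightarrow> \<sigma> x \<in> free_carrier H"
  shows "subst \<sigma> f \<in> free_carrier H"
  unfolding subst_def using assms
  by (intro sum_closed mult_closed const_closed prod_list_closed) (auto simp: free_carrier_iff[of f])

text \<open>A composite of substitutions is multiplicative and fixes scalars, so it fixes every word
  in \<open>G\<close> once it fixes each generator.\<close>

lemma subst_subst_eq:
  assumes "f \<in> free_carrier G" "\<And>x. x \<in> G \<Longrightarrow> subst \<tau> (\<sigma> x) = gen x"
  shows "subst \<tau> (subst \<sigma> f) = f"
proof (induction f rule: poly_mapping_sum_induct)
  case (single w)
  have "set (letters w) \<subseteq> G"
    using single assms(1) by (auto simp: free_carrier_iff)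
  then have "map (subst \<tau> \<circ> \<sigma>) (letters w) = map gen (letters w)"
    using assms(2) by auto
  then show ?case
    unfolding subst_single subst_mult subst_prod_list
    by (simp add: single_eq_const_mult_gens cong: map_cong)
qed (simp_all add: subst_add)

lemma subst_ring_hom:
  assumes "\<And>x. x \<in> G \<Longrightarrow> \<sigma> x \<in> free_carrier H"
  shows "subst \<sigma> \<in> Ring.ring_hom (free_algebra S G) (free_algebra S H)"
  by (rule ring_hom_memI)
     (simp_all add: free_algebra_ops subst_simps subst_closed assms)

end


section \<open>Isomorphisms of presented algebras\<close>

lemma image_a_r_coset:
  assumes "f \<in> Ring.ring_hom R S" "I \<subseteq> carrier R" "a \<in> carrier R"
  shows "f ` (I +>\<^bsub>R\<^esub> a) = f ` I +>\<^bsub>S\<^esub> f a"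
proof -
  have "f (h \<oplus>\<^bsub>R\<^esub> a) = f h \<oplus>\<^bsub>S\<^esub> f a" if "h \<in> I" for h
    using that assms by (intro ring_hom_add) auto
  then show ?thesis
    by (simp add: a_r_coset_def' UNION_singleton_eq_range image_image)
qed

text \<open>The induced map takes images of cosets as sets. No representatives are chosen, so it is
  well defined at once, and it inherits injectivity from \<open>f\<close> on subsets of the
  carrier.\<close>

lemma quotient_algebra_isomorphic:
  fixes A :: "('k, 'a) module" and B :: "('k, 'b) module"
  assumes "ideal I A" "ideal J B" "f \<in> ring_iso A B" "f ` I = J"
    and smult_A: "\<And>c a. c \<in> carrier K \<Longrightarrow> a \<in> carrier A \<Longrightarrow> c \<odot>\<^bsub>A\<^esub> a \<in> carrier A"
    and smult: "\<And>c a. c \<in> carrier K \<Longrightarrow> a \<in> carrier A \<Longrightarrow> f (c \<odot>\<^bsub>A\<^esub> a) = c \<odot>\<^bsub>B\<^esub> f a"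
  shows "algebra_isomorphic K (quotient_algebra A I) (quotient_algebra B J)"
proof -
  interpret I: ideal I A by fact
  interpret J: ideal J B by fact
  have hom: "f \<in> Ring.ring_hom A B" and bij: "bij_betw f (carrier A) (carrier B)"
    using \<open>f \<in> ring_iso A B\<close> by (auto simp: ring_iso_def)
  have closed: "f a \<in> carrier B" if "a \<in> carrier A" for a
    using that hom by (rule ring_hom_closed[rotated])
  have coset: "f ` (I +>\<^bsub>A\<^esub> a) = J +>\<^bsub>B\<^esub> f a" if "a \<in> carrier A" for a
    using image_a_r_coset[OF hom _ that, of I] I.a_subset \<open>f ` I = J\<close> by simp
  have carrier_A: "carrier (A Quot I) = (\<lambda>a. I +>\<^bsub>A\<^esub> a) ` carrier A"
    and carrier_B: "carrier (B Quot J) = (\<lambda>b. J +>\<^bsub>B\<^esub> b) ` carrier B"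
    by (auto simp: FactRing_simps)
  have Quot_subset: "C \<subseteq> carrier A" if "C \<in> carrier (A Quot I)" for C
    using that I.a_rcosets_carrier by (auto simp: FactRing_def)
  have "(\<lambda>C. f ` C) \<in> ring_iso (A Quot I) (B Quot J)"
  proof (rule ring_iso_memI)
    fix C assume "C \<in> carrier (A Quot I)"
    then show "f ` C \<in> carrier (B Quot J)"
      by (auto simp: carrier_A carrier_B coset closed)
  next
    fix C D assume "C \<in> carrier (A Quot I)" "D \<in> carrier (A Quot I)"
    then obtain a b where ab: "a \<in> carrier A" "b \<in> carrier A" "C = I +>\<^bsub>A\<^esub> a" "D = I +>\<^bsub>A\<^esub> b"
      by (auto simp: carrier_A)
    show "f ` (C \<otimes>\<^bsub>A Quot I\<^esub> D) = f ` C \<otimes>\<^bsub>B Quot J\<^esub> f ` D"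
      using ab by (simp add: FactRing_def I.rcoset_mult_add J.rcoset_mult_add coset closed ring_hom_mult[OF hom])
    show "f ` (C \<oplus>\<^bsub>A Quot I\<^esub> D) = f ` C \<oplus>\<^bsub>B Quot J\<^esub> f ` D"
      using ab by (simp add: FactRing_def I.a_rcos_sum J.a_rcos_sum coset closed ring_hom_add[OF hom])
  next
    show "f ` \<one>\<^bsub>A Quot I\<^esub> = \<one>\<^bsub>B Quot J\<^esub>"
      by (simp add: FactRing_def coset ring_hom_one[OF hom])
  next
    have "inj_on (\<lambda>C. f ` C) (carrier (A Quot I))"
      by (rule inj_onI) (metis bij bij_betw_def inj_on_image_eq_iff Quot_subset)
    moreover have "(\<lambda>C. f ` C) ` carrier (A Quot I) = carrier (B Quot J)"
    proof -
      have "(\<lambda>C. f ` C) ` carrier (A Quot I) = (\<lambda>a. J +>\<^bsub>B\<^esub> f a) ` carrier A"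
        by (auto simp: carrier_A image_image coset)
      also have "\<dots> = (\<lambda>b. J +>\<^bsub>B\<^esub> b) ` f ` carrier A"
        by (simp add: image_image)
      finally show ?thesis
        using bij by (simp add: carrier_B bij_betw_def)
    qed
    ultimately show "bij_betw (\<lambda>C. f ` C) (carrier (A Quot I)) (carrier (B Quot J))"
      by (simp add: bij_betw_def)
  qed
  then have "(\<lambda>C. f ` C) \<in> ring_iso (quotient_algebra A I) (quotient_algebra B J)"
    by (simp add: ring_iso_def Ring.ring_hom_def quotient_algebra_def)
  moreover have "f ` (c \<odot>\<^bsub>quotient_algebra A I\<^esub> C) = c \<odot>\<^bsub>quotient_algebra B J\<^esub> (f ` C)"
    if "c \<in> carrier K" "C \<in> carrier (quotient_algebra A I)" for c C
  proof -
    \<comment> \<open>The scalar action on the quotient is a union over all elements of the coset,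
      so compatibility is checked for each of them.\<close>
    have "C \<subseteq> carrier A"
      using that(2) Quot_subset by (simp add: quotient_algebra_def)
    with that(1) show ?thesis
      by (auto simp: quotient_algebra_def image_UN coset smult_A smult subset_iff)
  qed
  ultimately show ?thesis
    unfolding algebra_isomorphic_def algebra_iso_def by blast
qed

context scalar_subring
begin

definition relation_ideal :: "'g set \<Rightarrow> (('g word \<Rightarrow>\<^sub>0 'k) \<times> ('g word \<Rightarrow>\<^sub>0 'k)) set \<Rightarrow> ('g word \<Rightarrow>\<^sub>0 'k) set" where
  "relation_ideal G Rel = Idl\<^bsub>free_algebra S G\<^esub> ((\<lambda>(u, v). u - v) ` Rel)"

lemma differences_subset:
  assumes "Rel \<subseteq> free_carrier G \<times> free_carrier G"
  shows "(\<lambda>(u, v). u - v) ` Rel \<subseteq> free_carrier G"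
  using assms by (auto intro: diff_closed)

lemma ideal_relation_ideal:
  assumes "Rel \<subseteq> free_carrier G \<times> free_carrier G"
  shows "ideal (relation_ideal G Rel) (free_algebra S G)"
  unfolding relation_ideal_def
  by (intro ring.genideal_ideal ring_free_algebra differences_subset assms)

lemma relation_in_ideal:
  assumes "Rel \<subseteq> free_carrier G \<times> free_carrier G" "(u, v) \<in> Rel"
  shows "u - v \<in> relation_ideal G Rel"
  using ring.genideal_self[OF ring_free_algebra differences_subset[OF assms(1)]] assms(2)
  unfolding relation_ideal_def by auto

text \<open>The preimage of an ideal under a homomorphism is an ideal. It contains the differences
  that generate the source ideal, hence all of that ideal.\<close>

lemma subst_relation_ideal:
  assumes G: "Rel \<subseteq> free_carrier G \<times> free_carrier G" and H: "Rel' \<subseteq> free_carrier H \<times> free_carrier H"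
    and \<sigma>: "\<And>x. x \<in> G \<Longrightarrow> \<sigma> x \<in> free_carrier H"
    and rel: "\<And>u v. (u, v) \<in> Rel \<Longrightarrow> subst \<sigma> u - subst \<sigma> v \<in> relation_ideal H Rel'"
  shows "subst \<sigma> ` relation_ideal G Rel \<subseteq> relation_ideal H Rel'"
proof -
  interpret hom: ring_hom_ring "free_algebra S G" "free_algebra S H" "subst \<sigma>"
    by (intro ring_hom_ringI2 ring_free_algebra subst_ring_hom \<sigma>)
  have "ideal {f \<in> free_carrier G. subst \<sigma> f \<in> relation_ideal H Rel'} (free_algebra S G)"
    by (rule hom.ideal_vimage[OF ideal_relation_ideal[OF H]])
  moreover have "(\<lambda>(u, v). u - v) ` Rel \<subseteq> {f \<in> free_carrier G. subst \<sigma> f \<in> relation_ideal H Rel'}"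
    using differences_subset[OF G] rel by (auto simp: subst_diff)
  ultimately have "relation_ideal G Rel \<subseteq> {f \<in> free_carrier G. subst \<sigma> f \<in> relation_ideal H Rel'}"
    unfolding relation_ideal_def by (rule ring.genideal_minimal[OF ring_free_algebra])
  then show ?thesis
    by auto
qed

text \<open>The substitutions are required to be mutually inverse on the free algebras themselves,
  not merely modulo the relations. This leaves only the equality of the two ideals, which is checked
  on relations.\<close>

theorem presented_algebra_isomorphic:
  assumes K: "carrier K = S"
    and G: "Rel \<subseteq> free_carrier G \<times> free_carrier G" and H: "Rel' \<subseteq> free_carrier H \<times> free_carrier H"
    and \<sigma>: "\<And>x. x \<in> G \<Longrightarrow> \<sigma> x \<in> free_carrier H" and \<tau>: "\<And>x. x \<in> H \<Longrightarrow> \<tau> x \<in> free_carrier G"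
    and \<sigma>\<tau>: "\<And>x. x \<in> H \<Longrightarrow> subst \<sigma> (\<tau> x) = gen x" and \<tau>\<sigma>: "\<And>x. x \<in> G \<Longrightarrow> subst \<tau> (\<sigma> x) = gen x"
    and rel: "\<And>u v. (u, v) \<in> Rel \<Longrightarrow> subst \<sigma> u - subst \<sigma> v \<in> relation_ideal H Rel'"
    and rel': "\<And>u v. (u, v) \<in> Rel' \<Longrightarrow> subst \<tau> u - subst \<tau> v \<in> relation_ideal G Rel"
  shows "algebra_isomorphic K (presented_algebra S G Rel) (presented_algebra S H Rel')"
  unfolding presented_algebra_def relation_ideal_def[symmetric]
proof (rule quotient_algebra_isomorphic)
  have ideal_subset: "relation_ideal H Rel' \<subseteq> free_carrier H"
    using ideal.Icarr[OF ideal_relation_ideal[OF H]] by auto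
  have "subst \<sigma> ` relation_ideal G Rel \<subseteq> relation_ideal H Rel'"
    by (rule subst_relation_ideal[OF G H \<sigma> rel])
  moreover have "relation_ideal H Rel' \<subseteq> subst \<sigma> ` relation_ideal G Rel"
  proof
    fix f assume f: "f \<in> relation_ideal H Rel'"
    then have "subst \<tau> f \<in> relation_ideal G Rel"
      using subst_relation_ideal[OF H G \<tau> rel'] by blast
    moreover have "f = subst \<sigma> (subst \<tau> f)"
      using f ideal_subset subst_subst_eq[OF _ \<sigma>\<tau>, of f H] by auto
    ultimately show "f \<in> subst \<sigma> ` relation_ideal G Rel"
      by blast
  qed
  ultimately show "subst \<sigma> ` relation_ideal G Rel = relation_ideal H Rel'"
    by blast
  have "bij_betw (subst \<sigma>) (free_carrier G) (free_carrier H)"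
    by (rule bij_betw_byWitness[of _ "subst \<tau>"])
       (auto simp: subst_subst_eq[OF _ \<sigma>\<tau>] subst_subst_eq[OF _ \<tau>\<sigma>] subst_closed[OF _ \<sigma>] subst_closed[OF _ \<tau>])
  then show "subst \<sigma> \<in> ring_iso (free_algebra S G) (free_algebra S H)"
    using subst_ring_hom[OF \<sigma>] by (auto simp: ring_iso_def)
qed (use G H in \<open>simp_all add: ideal_relation_ideal\<close>,
     simp_all add: K free_algebra_ops subst_simps mult_closed const_closed)

end


section \<open>Roots of unity\<close>

lemma of_complex_simps:
  "of_complex 0 = 0" "of_complex 1 = 1"
  "of_complex (a + b) = of_complex a + of_complex b" "of_complex (a - b) = of_complex a - of_complex b"
  "of_complex (a * b) = of_complex a * of_complex b"
  by (simp_all add: of_complex_def mult_pCons_left flip: to_fract_add to_fract_diff to_fract_mult one_pCons)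

lemma of_complex_power: "of_complex (a ^ k) = of_complex a ^ k"
  by (induction k) (simp_all add: of_complex_simps)

lemma of_complex_sum: "of_complex (\<Sum>x\<in>A. f x) = (\<Sum>x\<in>A. of_complex (f x))"
  by (induction A rule: infinite_finite_induct) (simp_all add: of_complex_simps)

lemma qvar_neq_0: "qvar \<noteq> 0"
  by (simp add: qvar_def)

lemma xi_power_eq_cis: "xi r ^ k = cis (2 * pi * real k / real r)"
proof -
  have "xi r = cis (2 * pi / real r)"
    unfolding xi_def cis_conv_exp by (simp add: mult_ac)
  then show ?thesis
    by (simp add: DeMoivre mult_ac)
qed

lemma xi_power_r: "r \<ge> 1 \<Longrightarrow> xi r ^ r = 1"
  by (simp add: xi_power_eq_cis)

lemma xi_neq_0 [simp]: "xi r \<noteq> 0"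
  by (simp add: xi_def)

lemma xi_power_inj_less:
  assumes "i < r" "j < r" "xi r ^ i = xi r ^ j"
  shows "i = j"
proof -
  have "inj_on (\<lambda>k. xi r ^ k) {..<r}"
    using bij_betw_roots_unity[of r] assms(1) by (auto simp: xi_power_eq_cis bij_betw_def)
  then show ?thesis
    using assms by (auto dest: inj_onD)
qed

lemma xi_power_inj:
  assumes "c \<in> {1..r}" "d \<in> {1..r}" "xi r ^ c = xi r ^ d"
  shows "c = d"
proof -
  \<comment> \<open>Cancelling one factor \<xi> moves the exponents from 1..r to 0..r-1, where
    distinctness is known.\<close>
  have "xi r ^ c = xi r * xi r ^ (c - 1)" "xi r ^ d = xi r * xi r ^ (d - 1)"
    using assms by (simp_all flip: power_Suc)
  then have "xi r ^ (c - 1) = xi r ^ (d - 1)"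
    using assms(3) by simp
  then have "c - 1 = d - 1"
    using assms(1,2) by (intro xi_power_inj_less[of _ r]) auto
  then show ?thesis
    using assms(1,2) unfolding atLeastAtMost_iff by linarith
qed

lemma sum_powers_root_of_unity:
  fixes w :: complex
  assumes "w ^ r = 1"
  shows "(\<Sum>k<r. w ^ k) = (if w = 1 then of_nat r else 0)"
  using assms by (simp add: sum_gp_strict)

text \<open>Orthogonality of the characters of the cyclic group of order \<open>r\<close>. It yields
  the inverse of the matrix A and the eigenvalues of the projections and of
  \<open>coinciding\<close>.\<close>

lemma sum_xi_quotient_powers:
  assumes "c \<in> {1..r}" "d \<in> {1..r}"
  shows "(\<Sum>k<r. (xi r ^ c * inverse (xi r) ^ d) ^ k) = (if c = d then of_nat r else 0)"
proof -
  have "(xi r ^ c * inverse (xi r) ^ d) ^ r = (xi r ^ r) ^ c * inverse (xi r ^ r) ^ d"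
    unfolding power_mult_distrib by (simp add: mult.commute flip: power_mult power_inverse)
  then have "(xi r ^ c * inverse (xi r) ^ d) ^ r = 1"
    using assms by (simp add: xi_power_r)
  moreover have "xi r ^ c * inverse (xi r) ^ d = 1 \<longleftrightarrow> c = d"
    using xi_power_inj[OF assms] by (auto simp: field_simps power_inverse)
  ultimately show ?thesis
    by (simp add: sum_powers_root_of_unity)
qed

text \<open>The dual orthogonality relation, summed over the eigenvalue exponent; it makes the
  projections sum to 1.\<close>

lemma sum_inverse_xi_powers:
  assumes "k < r"
  shows "(\<Sum>c=1..r. inverse (xi r) ^ (c * k)) = (if k = 0 then of_nat r else 0)"
proof -
  let ?w = "inverse (xi r) ^ k"
  have "?w ^ r = inverse (xi r ^ r) ^ k"
    by (simp add: mult.commute power_inverse flip: power_mult)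
  then have w: "?w ^ r = 1"
    using assms by (simp add: xi_power_r)
  have "?w = 1 \<longleftrightarrow> k = 0"
    using xi_power_inj_less[of k r 0] assms by (auto simp: power_inverse)
  moreover have "(\<Sum>c=1..r. inverse (xi r) ^ (c * k)) = (\<Sum>c<r. ?w ^ Suc c)"
    by (rule sum.reindex_bij_witness[of _ Suc "\<lambda>c. c - 1"]) (auto simp: mult.commute simp flip: power_mult power_Suc)
  moreover have "\<dots> = ?w * (\<Sum>c<r. ?w ^ c)"
    by (simp add: sum_distrib_left)
  ultimately show ?thesis
    by (simp add: sum_powers_root_of_unity[OF w])
qed

lemma inverse_xi_eq_power: "r \<ge> 1 \<Longrightarrow> inverse (xi r) = xi r ^ (r - 1)"
  using xi_power_r[of r] by (cases r) (auto simp: field_simps)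

text \<open>Both sides are monic of degree \<open>r\<close> and vanish at the \<open>r\<close>
  distinct powers of \<xi>. This identifies the order relation for each \<omega> with the one for
  each t.\<close>

lemma prod_linear_xi:
  assumes "r \<ge> 1"
  shows "(\<Prod>k\<leftarrow>[1..<r + 1]. [:- (xi r ^ k), 1:]) = monom 1 r - 1"
proof -
  define p where "p = (\<Prod>k\<leftarrow>[1..<r + 1]. [:- (xi r ^ k), 1:])"
  have "p = prod (\<lambda>k. [:- (xi r ^ k), 1:]) (set [1..<r + 1])"
    unfolding p_def by (rule prod.distinct_set_conv_list[symmetric]) simp
  also have "set [1..<r + 1] = {1..r}"
    by auto
  finally have p: "p = (\<Prod>k=1..r. [:- (xi r ^ k), 1:])" .
  have "degree p = r"
    unfolding p by (subst degree_prod_eq_sum_degree) auto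
  moreover have "lead_coeff p = 1"
    unfolding p by (simp add: lead_coeff_prod)
  moreover have "degree (monom 1 r - 1 :: complex poly) \<le> r"
    by (rule degree_diff_le) (simp_all add: degree_monom_le)
  moreover have "card ((\<lambda>k. xi r ^ k) ` {1..r}) = r"
    by (subst card_image) (auto intro!: inj_onI xi_power_inj)
  moreover have "poly p z = poly (monom 1 r - 1) z" if "z \<in> (\<lambda>k. xi r ^ k) ` {1..r}" for z
  proof -
    have "poly p z = 0"
      using that unfolding p by (auto simp: poly_prod)
    moreover obtain k where "z = xi r ^ k"
      using \<open>z \<in> _\<close> by blast
    then have "z ^ r = (xi r ^ r) ^ k"
      by (simp add: mult.commute flip: power_mult)
    then have "z ^ r = 1"
      using assms by (simp add: xi_power_r)
    ultimately show ?thesis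
      by (simp add: poly_monom)
  qed
  ultimately have "p = monom 1 r - 1"
    using assms by (intro poly_eqI_degree_lead_coeff[of _ r _ "(\<lambda>k. xi r ^ k) ` {1..r}"]) auto
  then show ?thesis
    by (simp add: p_def)
qed

lemma Delta_neq_0: "Delta r \<noteq> 0"
proof -
  have "xi r ^ i - xi r ^ j \<noteq> 0" if "i \<in> {1..r}" "j \<in> {1..<i}" for i j
    using that xi_power_inj[of i r j] by auto
  then show ?thesis
    by (auto simp: Delta_def)
qed

section \<open>Explicit inverse of the matrix A\<close>

lemma mat_inverse_eqI:
  fixes A :: "'a::field mat"
  assumes "A \<in> carrier_mat n n" "B \<in> carrier_mat n n" "B * A = 1\<^sub>m n"
  shows "mat_inverse A = Some B"
proof (cases "mat_inverse A")
  case None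
  \<comment> \<open>The value \<open>None\<close> would mean that \<open>A\<close> is not a unit,
    but a left inverse of a square matrix over a field is also a right inverse.\<close>
  then have "A \<notin> Units (ring_mat TYPE('a) n ())"
    using mat_inverse(1)[OF assms(1), where b = "()"] by blast
  moreover have "A * B = 1\<^sub>m n"
    using mat_mult_left_right_inverse[OF assms(2,1,3)] .
  ultimately show ?thesis
    using assms by (auto simp: Units_def ring_mat_def)
next
  case (Some C)
  then have "A * C = 1\<^sub>m n" "C \<in> carrier_mat n n"
    using mat_inverse(2)[OF assms(1)] by auto
  then have "B = B * A * C"
    using assms by (metis assoc_mult_mat right_mult_one_mat)
  then show ?thesis
    using Some assms(3) \<open>C \<in> _\<close> by simp
qed

text \<open>A is a discrete Fourier matrix, so by orthogonality its inverse is the transpose of its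
  entrywise inverse, divided by \<open>r\<close>.\<close>

lemma h_coeff_eq:
  assumes "i \<in> {1..r}" "j \<in> {1..r}"
  shows "h_coeff r i j = Delta r * (inverse (xi r) ^ (i * (j - 1)) / of_nat r)"
proof -
  \<comment> \<open>Row \<open>i\<close>, counted from 0, belongs to the eigenvalue exponent
    \<open>i + 1\<close>.\<close>
  define B where "B = mat r r (\<lambda>(i, j). inverse (xi r) ^ ((i + 1) * j) / of_nat r)"
  have "B * A_mat r = 1\<^sub>m r"
  proof (rule eq_matI)
    fix i j assume "i < dim_row (1\<^sub>m r :: complex mat)" "j < dim_col (1\<^sub>m r :: complex mat)"
    then have ij: "i < r" "j < r"
      by auto
    then have "(B * A_mat r) $$ (i, j)
        = (\<Sum>k<r. inverse (xi r) ^ ((i + 1) * k) / of_nat r * xi r ^ ((j + 1) * k))"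
      by (simp add: B_def A_mat_def scalar_prod_def lessThan_atLeast0)
    also have "\<dots> = (\<Sum>k<r. (xi r ^ (j + 1) * inverse (xi r) ^ (i + 1)) ^ k) / of_nat r"
      unfolding sum_divide_distrib power_mult power_mult_distrib by (simp add: mult.commute)
    also have "\<dots> = 1\<^sub>m r $$ (i, j)"
      using ij by (subst sum_xi_quotient_powers) auto
    finally show "(B * A_mat r) $$ (i, j) = 1\<^sub>m r $$ (i, j)" .
  qed (simp_all add: B_def A_mat_def)
  then have "mat_inverse (A_mat r) = Some B"
    by (intro mat_inverse_eqI[of _ r]) (simp_all add: A_mat_def B_def)
  then show ?thesis
    using assms by (cases i) (auto simp: h_coeff_def B_def)
qed


section \<open>Spectral projections of an element of order \<open>r\<close>\<close>

text \<open>The Lagrange interpolation polynomial at the eigenvalue \<open>\<xi>\<^sup>c\<close>, which equals \<open>F\<^sub>c / \<Delta>\<close>.\<close>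

definition proj :: "nat \<Rightarrow> nat \<Rightarrow> ('g word \<Rightarrow>\<^sub>0 complex poly fract) \<Rightarrow> 'g word \<Rightarrow>\<^sub>0 complex poly fract" where
  "proj r c x = (\<Sum>k<r. cst (inverse (xi r) ^ (c * k) * inverse (of_nat r)) * x ^ k)"

text \<open>After exchanging the sums only the coefficient of x^0 survives. This is an identity in
  the free algebra, with no relation imposed on \<open>x\<close>.\<close>

lemma sum_proj:
  assumes "r \<ge> 1"
  shows "(\<Sum>c=1..r. proj r c x) = 1"
proof -
  have "(\<Sum>c=1..r. proj r c x)
      = (\<Sum>k<r. cst ((\<Sum>c=1..r. inverse (xi r) ^ (c * k)) * inverse (of_nat r)) * x ^ k)"
    unfolding proj_def
    by (subst sum.swap) (simp add: sum_distrib_right const_sum of_complex_sum)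
  also have "\<dots> = (\<Sum>k<r. if k = 0 then 1 else 0)"
    by (intro sum.cong) (auto simp: sum_inverse_xi_powers[unfolded One_nat_def] of_complex_simps(1,2))
  also have "\<dots> = 1"
    using assms by simp
  finally show ?thesis .
qed

lemma F_eval_eq:
  assumes "c \<in> {1..r}"
  shows "F_eval r c x = cst (Delta r) * proj r c x"
proof -
  have "F_eval r c x = (\<Sum>j=1..r. cst (Delta r * (inverse (xi r) ^ (c * (j - 1)) * inverse (of_nat r))) * x ^ (j - 1))"
    using assms by (simp add: F_eval_def h_coeff_eq divide_inverse)
  also have "\<dots> = (\<Sum>k<r. cst (Delta r * (inverse (xi r) ^ (c * k) * inverse (of_nat r))) * x ^ k)"
    by (rule sum.reindex_bij_witness[of _ Suc "\<lambda>j. j - 1"]) auto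
  finally show ?thesis
    by (simp add: proj_def sum_distrib_left of_complex_simps const_mult mult.assoc)
qed

lemma const_mult_const_mult: "const a * (const b * f) = const (a * b) * f"
  by (simp add: const_mult mult.assoc)

text \<open>The two factors F each contribute one \<Delta>, which cancels the scalar \<Delta>^-2 in
  front.\<close>

lemma ak_correction_eq:
  "ak_correction r j = (\<Sum>c\<^sub>2=1..r. \<Sum>c\<^sub>1=1..<c\<^sub>2. const (of_complex (xi r ^ c\<^sub>2 - xi r ^ c\<^sub>1) * (qvar - inverse qvar)) *
     (proj r c\<^sub>1 (ako (j - 1)) * proj r c\<^sub>2 (ako j)))"
proof -
  have "inverse (Delta r ^ 2) * (Delta r * Delta r) = 1"
    using Delta_neq_0[of r] by (simp flip: power2_eq_square)
  then have *: "of_complex (inverse (Delta r ^ 2)) * (of_complex (Delta r) * of_complex (Delta r)) = 1"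
    by (metis of_complex_simps(2,5))
  have key: "of_complex (inverse (Delta r ^ 2)) * (a * (b * (of_complex (Delta r) * of_complex (Delta r)))) = a * b" for a b
    by (metis * mult.commute mult.left_commute mult.right_neutral)
  have "cst (inverse (Delta r ^ 2)) *
      (const a * const b * (cst (Delta r) * P) * (cst (Delta r) * Q)) = const (a * b) * (P * Q)"
    for a b and P Q :: ak_free
    by (simp add: mult.assoc const_left_commute[of P] const_mult_const_mult key)
  then show ?thesis
    unfolding ak_correction_def sum_distrib_left by (intro sum.cong refl) (simp add: F_eval_eq)
qed

text \<open>Horner evaluation at an element of a noncommutative algebra; it transports the
  factorization of X^r - 1.\<close>

definition poly_at :: "('g word \<Rightarrow>\<^sub>0 complex poly fract) \<Rightarrow> complex poly \<Rightarrow> 'g word \<Rightarrow>\<^sub>0 complex poly fract" where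
  "poly_at x p = fold_coeffs (\<lambda>a f. cst a + x * f) p 0"

lemma poly_at_0 [simp]: "poly_at x 0 = 0"
  by (simp add: poly_at_def)

lemma poly_at_pCons [simp]: "poly_at x (pCons a p) = cst a + x * poly_at x p"
  by (cases "p = 0"; cases "a = 0") (simp_all add: poly_at_def of_complex_simps)

lemma poly_at_1 [simp]: "poly_at x 1 = 1"
  unfolding one_pCons by (simp add: of_complex_simps)

lemma poly_at_diff: "poly_at x (p - q) = poly_at x p - poly_at x q"
  by (induction p q rule: poly_induct2) (simp_all add: of_complex_simps const_diff right_diff_distrib)

lemma poly_at_smult: "poly_at x (smult a p) = cst a * poly_at x p"
  by (induction p)
     (simp_all add: of_complex_simps const_mult distrib_left const_left_commute[of x])

lemma poly_at_monom: "poly_at x (monom 1 k) = x ^ k"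
  by (induction k) (simp_all add: monom_Suc monom_0 of_complex_simps)

lemma prod_linear_factors:
  assumes "r \<ge> 1"
  shows "(\<Prod>k\<leftarrow>[1..<r + 1]. x - cst (xi r ^ k)) = x ^ r - 1"
proof -
  \<comment> \<open>Multiplicativity is needed only for a linear left factor, since the list product
    is built one factor at a time.\<close>
  have "poly_at x ([:- a, 1:] * p) = (x - cst a) * poly_at x p" for a p
  proof -
    have "[:- a, 1:] * p = pCons 0 p - smult a p"
      by simp
    then show ?thesis
      by (simp only: poly_at_diff poly_at_smult) (simp add: of_complex_simps left_diff_distrib)
  qed
  then have "poly_at x (\<Prod>k\<leftarrow>ks. [:- (xi r ^ k), 1:]) = (\<Prod>k\<leftarrow>ks. x - cst (xi r ^ k))" for ks
    by (induction ks) (simp_all add: del: mult_pCons_left)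
  from this[of "[1..<r + 1]"] show ?thesis
    unfolding prod_linear_xi[OF assms] by (simp add: poly_at_diff poly_at_monom)
qed


section \<open>Congruences modulo an ideal of a free algebra\<close>

locale free_algebra_ideal = scalar_subring S
  for S :: "complex poly fract set" +
  fixes G :: "'g set" and I :: "('g word \<Rightarrow>\<^sub>0 complex poly fract) set"
  assumes ideal: "ideal I (free_algebra S G)"
begin

abbreviation C :: "('g word \<Rightarrow>\<^sub>0 complex poly fract) set" where
  "C \<equiv> free_carrier G"

text \<open>Membership in \<open>C\<close> is built in because the ideal absorbs only multiplication
  by elements of \<open>C\<close>; closure conditions thus travel with the congruences.\<close>

definition cong (infix "\<approx>" 50) where
  "f \<approx> g \<longleftrightarrow> f \<in> C \<and> g \<in> C \<and> f - g \<in> I"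

lemma ideal_closed:
  "f \<in> I \<Longrightarrow> f \<in> C" "0 \<in> I" "f \<in> I \<Longrightarrow> g \<in> I \<Longrightarrow> f + g \<in> I"
  "f \<in> I \<Longrightarrow> g \<in> C \<Longrightarrow> g * f \<in> I" "f \<in> I \<Longrightarrow> g \<in> C \<Longrightarrow> f * g \<in> I" "f \<in> I \<Longrightarrow> - f \<in> I"
proof -
  have m1: "- 1 \<in> C" by (intro uminus_closed one_closed)
  interpret ideal I "free_algebra S G" by (rule ideal)
  show "f \<in> I \<Longrightarrow> f \<in> C" "0 \<in> I" "f \<in> I \<Longrightarrow> g \<in> I \<Longrightarrow> f + g \<in> I"
    and l: "f \<in> I \<Longrightarrow> g \<in> C \<Longrightarrow> g * f \<in> I" and "f \<in> I \<Longrightarrow> g \<in> C \<Longrightarrow> f * g \<in> I" for f g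
    using Icarr additive_subgroup.zero_closed[OF is_additive_subgroup]
      additive_subgroup.a_closed[OF is_additive_subgroup] I_l_closed I_r_closed
    by (simp_all add: free_algebra_ops)
  show "f \<in> I \<Longrightarrow> - f \<in> I"
    using l[OF _ m1, of f] by simp
qed

lemma cong_refl: "f \<in> C \<Longrightarrow> f \<approx> f"
  by (simp add: cong_def ideal_closed)

lemma cong_sym: "f \<approx> g \<Longrightarrow> g \<approx> f"
  using ideal_closed(6)[of "f - g"] by (simp add: cong_def)

lemma cong_trans [trans]: "f \<approx> g \<Longrightarrow> g \<approx> h \<Longrightarrow> f \<approx> h"
  using ideal_closed(3)[of "f - g" "g - h"] by (simp add: cong_def)

lemma cong_add: "f \<approx> f' \<Longrightarrow> g \<approx> g' \<Longrightarrow> f + g \<approx> f' + g'"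
  using ideal_closed(3)[of "f - f'" "g - g'"] by (simp add: cong_def add_closed add_diff_add)

lemma cong_uminus: "f \<approx> g \<Longrightarrow> - f \<approx> - g"
  using ideal_closed(6)[of "f - g"] by (simp add: cong_def uminus_closed)

lemma cong_diff: "f \<approx> f' \<Longrightarrow> g \<approx> g' \<Longrightarrow> f - g \<approx> f' - g'"
  using cong_add[OF _ cong_uminus] by fastforce

lemma cong_mult:
  assumes "f \<approx> f'" "g \<approx> g'"
  shows "f * g \<approx> f' * g'"
proof -
  have "f * g - f' * g' = f * (g - g') + (f - f') * g'"
    by (simp add: algebra_simps)
  then show ?thesis
    using assms unfolding cong_def by (simp add: mult_closed ideal_closed)
qed

lemmas cong_mult_left = cong_mult[OF cong_refl]
lemmas cong_mult_right = cong_mult[OF _ cong_refl]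

lemma cong_sum: "(\<And>x. x \<in> A \<Longrightarrow> f x \<approx> g x) \<Longrightarrow> (\<Sum>x\<in>A. f x) \<approx> (\<Sum>x\<in>A. g x)"
  by (induction A rule: infinite_finite_induct) (auto intro: cong_add cong_refl zero_closed)

lemma cong_iff_diff: "f \<in> C \<Longrightarrow> g \<in> C \<Longrightarrow> f \<approx> g \<longleftrightarrow> f - g \<approx> 0"
  by (simp add: cong_def diff_closed zero_closed)

text \<open>Intertwining by \<open>g\<close> passes to products here, and to powers, sums and scalar
  multiples below. Hence the way an element moves past \<open>g\<close> determines how its
  polynomials do.\<close>

lemma intertwine_mult:
  assumes "f * g \<approx> g * f'" "h * g \<approx> g * h'" "f \<in> C" "h \<in> C" "g \<in> C" "f' \<in> C" "h' \<in> C"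
  shows "f * h * g \<approx> g * (f' * h')"
proof -
  have "f * h * g = f * (h * g)" by (simp add: mult.assoc)
  also have "\<dots> \<approx> f * (g * h')" using assms by (intro cong_mult_left)
  also have "\<dots> = f * g * h'" by (simp add: mult.assoc)
  also have "\<dots> \<approx> g * f' * h'" using assms by (intro cong_mult_right)
  finally show ?thesis by (simp add: mult.assoc)
qed

lemma intertwine_power:
  assumes "f * g \<approx> g * f'" "f \<in> C" "g \<in> C" "f' \<in> C"
  shows "f ^ k * g \<approx> g * f' ^ k"
proof (induction k)
  case (Suc k)
  then show ?case
    using intertwine_mult[OF assms(1) Suc] assms by (simp add: power_closed)
qed (use assms in \<open>simp add: cong_refl\<close>)

lemma intertwine_sum:
  assumes "\<And>x. x \<in> A \<Longrightarrow> f x * g \<approx> g * f' x"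
  shows "(\<Sum>x\<in>A. f x) * g \<approx> g * (\<Sum>x\<in>A. f' x)"
  unfolding sum_distrib_left sum_distrib_right using assms by (rule cong_sum)

lemma intertwine_const:
  assumes "f * g \<approx> g * f'" "c \<in> S"
  shows "const c * f * g \<approx> g * (const c * f')"
  using cong_mult_left[OF const_closed[OF assms(2)] assms(1)]
  by (simp add: mult.assoc const_left_commute[of g])

end


section \<open>Commuting elements of order \<open>r\<close>\<close>

definition hecke_param :: "'g word \<Rightarrow>\<^sub>0 complex poly fract" where
  "hecke_param = const (qvar - inverse qvar)"

definition ascending ::
    "nat \<Rightarrow> (nat \<Rightarrow> 'g word \<Rightarrow>\<^sub>0 complex poly fract) \<Rightarrow> nat \<Rightarrow> nat \<Rightarrow> 'g word \<Rightarrow>\<^sub>0 complex poly fract" where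
  "ascending r t a b = (\<Sum>d=1..r. \<Sum>c=1..<d. proj r c (t a) * proj r d (t b))"

text \<open>The element \<open>e_i\<close> of the Yokonuma-Hecke algebra for an arbitrary pair of
  indices. Under the order and commutation relations it projects onto equal eigenvalues of
  \<open>t a\<close> and \<open>t b\<close>.\<close>

definition coinciding ::
    "nat \<Rightarrow> (nat \<Rightarrow> 'g word \<Rightarrow>\<^sub>0 complex poly fract) \<Rightarrow> nat \<Rightarrow> nat \<Rightarrow> 'g word \<Rightarrow>\<^sub>0 complex poly fract" where
  "coinciding r t a b = cst (inverse (of_nat r)) * (\<Sum>s<r. t a ^ s * t b ^ (r - s))"

text \<open>The correction term of the mixed Ariki-Koike relations after the powers of \<Delta> have
  cancelled.\<close>

definition correction ::
    "nat \<Rightarrow> (nat \<Rightarrow> 'g word \<Rightarrow>\<^sub>0 complex poly fract) \<Rightarrow> nat \<Rightarrow> nat \<Rightarrow> 'g word \<Rightarrow>\<^sub>0 complex poly fract" where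
  "correction r t a b = (\<Sum>d=1..r. \<Sum>c=1..<d.
     const (of_complex (xi r ^ d - xi r ^ c) * (qvar - inverse qvar)) * (proj r c (t a) * proj r d (t b)))"

lemma ye_eq: "ye r i = coinciding r yt i (i + 1)"
  by (simp add: ye_def coinciding_def)

lemma ak_correction_eq_correction: "ak_correction r j = correction r ako (j - 1) j"
  by (simp add: ak_correction_eq correction_def)

lemma subst_proj: "subst \<sigma> (proj r c x) = proj r c (subst \<sigma> x)"
  by (simp add: proj_def subst_simps)

lemma subst_coloring:
  "subst \<sigma> hecke_param = hecke_param"
  "subst \<sigma> (ascending r t a b) = ascending r (\<lambda>i. subst \<sigma> (t i)) a b"
  "subst \<sigma> (coinciding r t a b) = coinciding r (\<lambda>i. subst \<sigma> (t i)) a b"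
  "subst \<sigma> (correction r t a b) = correction r (\<lambda>i. subst \<sigma> (t i)) a b"
  by (simp_all add: hecke_param_def ascending_def coinciding_def correction_def subst_simps subst_proj)

text \<open>Closure facts only. They are kept apart from the congruences because the relations must
  be known to lie in the free algebra before they can generate an ideal there.\<close>

locale torsion_elements = scalar_subring S
  for S :: "complex poly fract set" +
  fixes G :: "'g set" and r n :: nat and t :: "nat \<Rightarrow> 'g word \<Rightarrow>\<^sub>0 complex poly fract"
  assumes r_pos: "r \<ge> 1"
    and q_closed: "qvar \<in> S" "inverse qvar \<in> S"
    and xi_closed: "of_complex (xi r) \<in> S"
    and inverse_r_closed: "of_complex (inverse (of_nat r)) \<in> S"
    and t_closed: "a \<in> {1..n} \<Longrightarrow> t a \<in> free_carrier G"
begin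

abbreviation p :: "nat \<Rightarrow> nat \<Rightarrow> 'g word \<Rightarrow>\<^sub>0 complex poly fract" where
  "p c a \<equiv> proj r c (t a)"

abbreviation T :: "nat \<Rightarrow> nat \<Rightarrow> 'g word \<Rightarrow>\<^sub>0 complex poly fract" where
  "T \<equiv> ascending r t"

abbreviation e :: "nat \<Rightarrow> nat \<Rightarrow> 'g word \<Rightarrow>\<^sub>0 complex poly fract" where
  "e \<equiv> coinciding r t"

abbreviation corr :: "nat \<Rightarrow> nat \<Rightarrow> 'g word \<Rightarrow>\<^sub>0 complex poly fract" where
  "corr \<equiv> correction r t"

abbreviation \<zeta> :: "'g word \<Rightarrow>\<^sub>0 complex poly fract" where
  "\<zeta> \<equiv> hecke_param"

lemma xi_power_closed: "of_complex (xi r ^ k) \<in> S"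
  by (simp add: of_complex_power scalar_power xi_closed)

lemma proj_coeff_closed: "of_complex (inverse (xi r) ^ k * inverse (of_nat r)) \<in> S"
  unfolding of_complex_simps inverse_xi_eq_power[OF r_pos] power_mult[symmetric]
  by (intro scalar_closed xi_power_closed inverse_r_closed)

lemma z_closed: "qvar - inverse qvar \<in> S"
  by (simp add: scalar_closed q_closed)

lemma p_closed: "a \<in> {1..n} \<Longrightarrow> p c a \<in> free_carrier G"
  unfolding proj_def
  by (intro sum_closed mult_closed const_closed proj_coeff_closed power_closed t_closed)

lemma zeta_closed: "\<zeta> \<in> free_carrier G"
  unfolding hecke_param_def by (intro const_closed z_closed)

lemma T_closed: "a \<in> {1..n} \<Longrightarrow> b \<in> {1..n} \<Longrightarrow> T a b \<in> free_carrier G"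
  unfolding ascending_def by (intro sum_closed mult_closed p_closed)

lemma e_closed: "a \<in> {1..n} \<Longrightarrow> b \<in> {1..n} \<Longrightarrow> e a b \<in> free_carrier G"
  unfolding coinciding_def
  by (intro sum_closed mult_closed power_closed t_closed const_closed inverse_r_closed)

lemma corr_closed: "a \<in> {1..n} \<Longrightarrow> b \<in> {1..n} \<Longrightarrow> corr a b \<in> free_carrier G"
  unfolding correction_def of_complex_simps
  by (intro sum_closed mult_closed p_closed const_closed scalar_closed z_closed xi_power_closed q_closed)

lemmas elements_closed = t_closed p_closed zeta_closed T_closed e_closed corr_closed

end

text \<open>The common ground of both algebras: \<open>t\<close> stands for the t's on one side and
  for the \<omega>'s on the other.\<close>

locale commuting_roots = torsion_elements S G r n t + free_algebra_ideal S G I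
  for S and G :: "'g set" and r n t I +
  assumes t_power_r: "a \<in> {1..n} \<Longrightarrow> t a ^ r \<approx> 1"
    and t_commute: "a \<in> {1..n} \<Longrightarrow> b \<in> {1..n} \<Longrightarrow> t a * t b \<approx> t b * t a"
begin

lemma zeta_left_commute: "f * (\<zeta> * g) = \<zeta> * (f * g)"
  by (simp add: hecke_param_def const_left_commute)

lemma intertwine_proj:
  assumes "f * g \<approx> g * f'" "f \<in> C" "g \<in> C" "f' \<in> C"
  shows "proj r c f * g \<approx> g * proj r c f'"
  unfolding proj_def
  by (intro intertwine_sum intertwine_const intertwine_power assms proj_coeff_closed)

lemma t_proj:
  assumes "a \<in> {1..n}"
  shows "t a * p c a \<approx> cst (xi r ^ c) * p c a"
proof -
  \<comment> \<open>The factor \<xi>^c is absorbed into the summand, so that multiplication by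
    \<open>t a\<close> merely shifts the index by one.\<close>
  define f where "f k = cst (xi r ^ c * (inverse (xi r) ^ (c * k) * inverse (of_nat r))) * t a ^ k" for k
  have coeff: "xi r ^ c * (inverse (xi r) ^ (c * Suc k) * x) = inverse (xi r) ^ (c * k) * x" for k x
    by (simp add: power_add power_inverse)
  have "t a * p c a = (\<Sum>k<r. f (Suc k))"
    unfolding proj_def sum_distrib_left f_def
    by (simp only: coeff const_left_commute[of "t a"] power_Suc)
  also have "\<dots> = (\<Sum>k<r. f k) + (f r - f 0)"
    using sum.lessThan_Suc_shift[of f r] by (simp add: algebra_simps)
  \<comment> \<open>The boundary terms \<open>f r\<close> and \<open>f 0\<close> agree because both
    \<open>t a ^ r\<close> and the r-th power of \<xi> reduce to 1.\<close>
  also have "\<dots> \<approx> (\<Sum>k<r. f k) + (f 0 - f 0)"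
  proof (intro cong_add cong_diff cong_refl sum_closed)
    have f_closed: "f k \<in> C" for k
      unfolding f_def of_complex_simps(5)[of "xi r ^ c"] using assms
      by (intro mult_closed const_closed power_closed t_closed scalar_closed xi_power_closed proj_coeff_closed)
    then show "f k \<in> C" "f k \<in> C" for k by blast+
    have "inverse (xi r) ^ (c * r) = 1"
      by (metis power_inverse mult.commute power_mult power_one xi_power_r[OF r_pos] inverse_1)
    then have "f r = f 0 * t a ^ r"
      by (simp add: f_def)
    also have "\<dots> \<approx> f 0 * 1"
      using assms by (intro cong_mult_left f_closed t_power_r)
    finally show "f r \<approx> f 0" by simp
  qed
  also have "\<dots> = cst (xi r ^ c) * p c a"
    by (simp add: f_def proj_def sum_distrib_left of_complex_simps(5)[of "xi r ^ c"] const_mult mult.assoc)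
  finally show ?thesis .
qed

text \<open>Here \<open>Q\<close> is an eigenvector of left multiplication by \<open>f\<close>
  modulo the ideal. The rules below turn congruences between polynomials in the t's into scalar
  identities.\<close>

definition eig where
  "eig f Q v \<longleftrightarrow> v \<in> S \<and> Q \<in> C \<and> f * Q \<approx> const v * Q"

lemma eig_const: "v \<in> S \<Longrightarrow> Q \<in> C \<Longrightarrow> eig (const v) Q v"
  by (simp add: eig_def cong_refl mult_closed const_closed)

lemma eig_add: "eig f Q v \<Longrightarrow> eig g Q w \<Longrightarrow> eig (f + g) Q (v + w)"
  using cong_add[of "f * Q" "const v * Q" "g * Q" "const w * Q"]
  by (simp add: eig_def scalar_closed const_add distrib_right)

lemma eig_mult:
  assumes "eig f Q v" "eig g Q w" "f \<in> C"
  shows "eig (f * g) Q (v * w)"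
proof -
  have "f * g * Q = f * (g * Q)"
    by (simp add: mult.assoc)
  also have "\<dots> \<approx> f * (const w * Q)"
    using assms by (intro cong_mult_left) (auto simp: eig_def)
  also have "\<dots> = const w * (f * Q)"
    by (rule const_left_commute)
  also have "\<dots> \<approx> const w * (const v * Q)"
    using assms by (intro cong_mult_left) (auto simp: eig_def const_closed)
  finally show ?thesis
    using assms by (simp add: eig_def scalar_closed const_mult_const_mult mult.commute)
qed

lemma eig_diff: "eig f Q v \<Longrightarrow> eig g Q w \<Longrightarrow> eig (f - g) Q (v - w)"
  using cong_diff[of "f * Q" "const v * Q" "g * Q" "const w * Q"]
  by (simp add: eig_def scalar_closed const_diff left_diff_distrib)

lemma eig_1: "Q \<in> C \<Longrightarrow> eig 1 Q 1"
  using eig_const[of 1 Q] by (simp add: scalar_closed)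

lemma eig_zeta: "Q \<in> C \<Longrightarrow> eig \<zeta> Q (qvar - inverse qvar)"
  unfolding hecke_param_def by (intro eig_const z_closed)

lemma eig_power: "eig f Q v \<Longrightarrow> f \<in> C \<Longrightarrow> eig (f ^ k) Q (v ^ k)"
  by (induction k) (simp_all add: eig_1 eig_mult eig_def[THEN iffD1])

lemma eig_sum:
  assumes "Q \<in> C" "\<And>x. x \<in> A \<Longrightarrow> eig (f x) Q (v x)"
  shows "eig (\<Sum>x\<in>A. f x) Q (\<Sum>x\<in>A. v x)"
  using assms(2)
proof (induction A rule: infinite_finite_induct)
qed (use assms(1) eig_const[of 0 Q] in \<open>auto intro: eig_add simp: scalar_closed\<close>)

text \<open>The exponent is normalized to 1..r so that colors can be compared as numbers; their
  order decides how \<open>T\<close> acts.\<close>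

definition color where
  "color Q a u \<longleftrightarrow> u \<in> {1..r} \<and> Q \<in> C \<and> eig (t a) Q (of_complex (xi r ^ u))"

text \<open>Evaluating the projection polynomial at the eigenvalue of color \<open>u\<close> gives a
  normalized character sum, to which orthogonality applies.\<close>

lemma color_proj:
  assumes "color Q a u" "c \<in> {1..r}" "a \<in> {1..n}"
  shows "eig (p c a) Q (of_bool (c = u))"
proof -
  have Q: "Q \<in> C" and u: "u \<in> {1..r}" and t: "eig (t a) Q (of_complex (xi r ^ u))"
    using assms(1) by (auto simp: color_def)
  have "eig (p c a) Q (\<Sum>k<r. of_complex (inverse (xi r) ^ (c * k) * inverse (of_nat r)) * of_complex (xi r ^ u) ^ k)"
    unfolding proj_def
    by (intro eig_sum Q eig_mult eig_const eig_power t proj_coeff_closed const_closed t_closed assms)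
  also have "(\<Sum>k<r. of_complex (inverse (xi r) ^ (c * k) * inverse (of_nat r)) * of_complex (xi r ^ u) ^ k)
      = of_complex ((\<Sum>k<r. (xi r ^ u * inverse (xi r) ^ c) ^ k) * inverse (of_nat r))"
    unfolding sum_distrib_right of_complex_sum of_complex_simps of_complex_power power_mult power_mult_distrib
    by (simp only: mult_ac)
  also have "\<dots> = of_bool (c = u)"
    unfolding sum_xi_quotient_powers[OF u assms(2)] using r_pos
    by (auto simp: of_complex_simps(1,2))
  finally show ?thesis .
qed

text \<open>Only the pair \<open>(u, v)\<close> can contribute, and it lies in the range of
  summation exactly if \<open>u < v\<close>.\<close>

lemma sum_ordered_pairs_delta:
  fixes k :: "nat \<Rightarrow> nat \<Rightarrow> complex poly fract"
  assumes "u \<in> {1..m}" "v \<in> {1..m}"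
  shows "(\<Sum>d=1..m. \<Sum>c=1..<d. k c d * (of_bool (c = u) * of_bool (d = v))) = of_bool (u < v) * k u v"
proof -
  have "(\<Sum>d=1..m. \<Sum>c=1..<d. k c d * (of_bool (c = u) * of_bool (d = v)))
      = (\<Sum>d=1..m. \<Sum>c=1..<d. if c = u then if d = v then k u v else 0 else 0)"
    by (intro sum.cong refl) auto
  also have "\<dots> = (\<Sum>d=1..m. if d = v then of_bool (u < v) * k u v else 0)"
    using assms by (intro sum.cong refl) auto
  also have "\<dots> = of_bool (u < v) * k u v"
    using assms by simp
  finally show ?thesis .
qed

lemma eig_T:
  assumes "color Q a u" "color Q b v" "a \<in> {1..n}" "b \<in> {1..n}"
  shows "eig (T a b) Q (of_bool (u < v))"
proof -
  have Q: "Q \<in> C" and uv: "u \<in> {1..r}" "v \<in> {1..r}"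
    using assms by (auto simp: color_def)
  have "eig (T a b) Q (\<Sum>d=1..r. \<Sum>c=1..<d. 1 * (of_bool (c = u) * of_bool (d = v)))"
    unfolding ascending_def mult_1 by (intro eig_sum Q eig_mult color_proj p_closed assms) auto
  then show ?thesis
    unfolding sum_ordered_pairs_delta[OF uv] by simp
qed

lemma eig_corr:
  assumes "color Q a u" "color Q b v" "a \<in> {1..n}" "b \<in> {1..n}"
  shows "eig (corr a b) Q (of_bool (u < v) * (of_complex (xi r ^ v - xi r ^ u) * (qvar - inverse qvar)))"
proof -
  have Q: "Q \<in> C" and uv: "u \<in> {1..r}" "v \<in> {1..r}"
    using assms by (auto simp: color_def)
  let ?k = "\<lambda>c d. of_complex (xi r ^ d - xi r ^ c) * (qvar - inverse qvar)"
  have k: "?k c d \<in> S" for c d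
    unfolding of_complex_simps by (intro scalar_closed xi_power_closed q_closed)
  have "eig (corr a b) Q (\<Sum>d=1..r. \<Sum>c=1..<d. ?k c d * (of_bool (c = u) * of_bool (d = v)))"
    unfolding correction_def
    by (intro eig_sum Q eig_mult eig_const color_proj p_closed const_closed k assms) auto
  then show ?thesis
    unfolding sum_ordered_pairs_delta[OF uv] .
qed

lemma eig_e:
  assumes "color Q a u" "color Q b v" "a \<in> {1..n}" "b \<in> {1..n}"
  shows "eig (e a b) Q (of_bool (u = v))"
proof -
  have Q: "Q \<in> C" and uv: "u \<in> {1..r}" "v \<in> {1..r}"
    and t: "eig (t a) Q (of_complex (xi r ^ u))" "eig (t b) Q (of_complex (xi r ^ v))"
    using assms by (auto simp: color_def)
  have "eig (e a b) Q (of_complex (inverse (of_nat r)) *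
      (\<Sum>s<r. of_complex (xi r ^ u) ^ s * of_complex (xi r ^ v) ^ (r - s)))"
    unfolding coinciding_def
    by (intro eig_mult eig_const eig_sum Q eig_power t power_closed t_closed const_closed inverse_r_closed assms)
  also have "(\<Sum>s<r. of_complex (xi r ^ u) ^ s * of_complex (xi r ^ v) ^ (r - s))
      = of_complex (\<Sum>s<r. (xi r ^ u * inverse (xi r) ^ v) ^ s)"
    unfolding of_complex_sum
  proof (intro sum.cong refl)
    fix s assume "s \<in> {..<r}"
    \<comment> \<open>The exponent \<open>r - s\<close> acts as \<open>- s\<close>; the subtraction
      is exact because \<open>s < r\<close>.\<close>
    then have "(xi r ^ v) ^ (r - s) * (xi r ^ v) ^ s = (xi r ^ v) ^ r"
      by (simp flip: power_add)
    also have "\<dots> = (xi r ^ r) ^ v"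
      by (simp add: mult.commute flip: power_mult)
    finally have "(xi r ^ v) ^ (r - s) * (xi r ^ v) ^ s = 1"
      unfolding xi_power_r[OF r_pos] by simp
    then have "(xi r ^ v) ^ (r - s) = (inverse (xi r) ^ v) ^ s"
      by (simp add: field_simps power_inverse)
    then show "of_complex (xi r ^ u) ^ s * of_complex (xi r ^ v) ^ (r - s)
        = of_complex ((xi r ^ u * inverse (xi r) ^ v) ^ s)"
      by (simp add: power_mult_distrib of_complex_simps flip: of_complex_power)
  qed
  also have "of_complex (inverse (of_nat r)) * \<dots> = of_bool (u = v)"
    unfolding sum_xi_quotient_powers[OF uv] using r_pos
    by (auto simp: of_complex_simps(1,2) simp flip: of_complex_simps(5))
  finally show ?thesis .
qed

lemma eig_cong:
  assumes "eig f Q v" "eig g Q v"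
  shows "f * Q \<approx> g * Q"
  using assms cong_trans cong_sym unfolding eig_def by blast

text \<open>Inserting the sum of the projections of \<open>t a\<close>, which is 1, on the right
  splits a congruence into eigencomponents.\<close>

lemma cong_by_proj:
  assumes "f \<in> C" "g \<in> C" "a \<in> {1..n}" "\<And>c. c \<in> {1..r} \<Longrightarrow> f * p c a \<approx> g * p c a"
  shows "f \<approx> g"
proof -
  have "f = f * (\<Sum>c=1..r. p c a)"
    by (simp add: sum_proj[OF r_pos, unfolded One_nat_def])
  also have "\<dots> \<approx> g * (\<Sum>c=1..r. p c a)"
    unfolding sum_distrib_left by (rule cong_sum[OF assms(4)])
  finally show ?thesis
    by (simp add: sum_proj[OF r_pos, unfolded One_nat_def])
qed

lemma color_own: "a \<in> {1..n} \<Longrightarrow> u \<in> {1..r} \<Longrightarrow> color (p u a) a u"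
  by (simp add: color_def eig_def t_proj p_closed xi_power_closed)

lemma color_mult_right: "color Q a u \<Longrightarrow> Q' \<in> C \<Longrightarrow> color (Q * Q') a u"
  using cong_mult_right[of "t a * Q" "cst (xi r ^ u) * Q" Q']
  by (auto simp: color_def eig_def mult.assoc mult_closed)

text \<open>The projection is a polynomial in \<open>t a\<close>, so it commutes with
  \<open>t b\<close> modulo the ideal and leaves the color for \<open>t b\<close> unchanged.\<close>

lemma color_mult_proj:
  assumes "color Q b v" "a \<in> {1..n}" "b \<in> {1..n}"
  shows "color (p c a * Q) b v"
proof -
  have Q: "Q \<in> C" and Qb: "t b * Q \<approx> cst (xi r ^ v) * Q"
    using assms by (auto simp: color_def eig_def)
  have "t b * (p c a * Q) = t b * p c a * Q"
    by (simp add: mult.assoc)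
  also have "\<dots> \<approx> p c a * t b * Q"
    using intertwine_proj[OF t_commute t_closed t_closed t_closed, of a b c] assms Q
    by (intro cong_mult_right) (auto intro: cong_sym)
  also have "\<dots> = p c a * (t b * Q)"
    by (simp add: mult.assoc)
  also have "\<dots> \<approx> p c a * (cst (xi r ^ v) * Q)"
    using assms by (intro cong_mult_left p_closed Qb)
  also have "\<dots> = cst (xi r ^ v) * (p c a * Q)"
    by (rule const_left_commute)
  finally show ?thesis
    using assms Q by (auto simp: color_def eig_def mult_closed p_closed)
qed

text \<open>
  Since the spectral projections of each \<open>t\<^sub>a\<close> sum to \<open>1\<close>, a congruence between polynomials in the
  \<open>t\<^sub>a\<close> can be checked by comparing eigenvalues.
\<close>

lemma diagonal_cong:
  assumes "f \<in> C" "g \<in> C" "i \<in> {1..n}" "j \<in> {1..n}" "k \<in> {1..n}"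
    and "\<And>Q u v w. color Q i u \<Longrightarrow> color Q j v \<Longrightarrow> color Q k w \<Longrightarrow> \<exists>x. eig f Q x \<and> eig g Q x"
  shows "f \<approx> g"
proof (rule cong_by_proj)
  fix w assume w: "w \<in> {1..r}"
  show "f * p w k \<approx> g * p w k"
  proof (rule cong_by_proj)
    fix v assume v: "v \<in> {1..r}"
    show "f * p w k * p v j \<approx> g * p w k * p v j"
    proof (rule cong_by_proj)
      fix u assume u: "u \<in> {1..r}"
      \<comment> \<open>Each factor supplies one color of \<open>?Q\<close>: the factors to its left
        are passed by \<open>color_mult_proj\<close>, and those to its right do not affect left
        multiplication.\<close>
      let ?Q = "p w k * (p v j * p u i)"
      note closed = p_closed[OF assms(3)] p_closed[OF assms(4)]
      have "color ?Q i u"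
        by (intro color_mult_proj color_own assms u)
      moreover have "color ?Q j v"
        by (intro color_mult_proj color_mult_right color_own closed assms v)
      moreover have "color ?Q k w"
        by (rule color_mult_right[OF color_own]) (intro mult_closed closed assms w)+
      ultimately show "f * p w k * p v j * p u i \<approx> g * p w k * p v j * p u i"
        using assms(6)[of ?Q u v w] eig_cong[of f ?Q _ g] unfolding mult.assoc by blast
    qed (intro mult_closed p_closed assms)+
  qed (intro mult_closed p_closed assms)+
qed (intro assms)+

end


section \<open>Comparison of the relations\<close>

context commuting_roots
begin

text \<open>Resolution with the rules for \<open>eig\<close> computes \<open>F\<close> and
  \<open>F'\<close> as functions of the three colors, so that only a scalar identity remains to be
  proved.\<close>

lemma diagonal_cong_eq:
  assumes "i \<in> {1..n}" "j \<in> {1..n}" "k \<in> {1..n}" "f \<in> C" "g \<in> C"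
    and "\<And>Q u v w. Q \<in> C \<Longrightarrow> color Q i u \<Longrightarrow> color Q j v \<Longrightarrow> color Q k w \<Longrightarrow> eig f Q (F u v w)"
    and "\<And>Q u v w. Q \<in> C \<Longrightarrow> color Q i u \<Longrightarrow> color Q j v \<Longrightarrow> color Q k w \<Longrightarrow> eig g Q (F' u v w)"
    and "\<And>u v w. F u v w = F' u v w"
  shows "f \<approx> g"
  using assms(4,5,1-3)
proof (rule diagonal_cong)
  fix Q u v w assume Q: "color Q i u" "color Q j v" "color Q k w"
  then have "Q \<in> C"
    by (simp add: color_def)
  then show "\<exists>x. eig f Q x \<and> eig g Q x"
    using assms(6,7)[OF _ Q] assms(8)[of u v w] by auto
qed

lemma eig_t: "color Q a u \<Longrightarrow> eig (t a) Q (of_complex (xi r ^ u))"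
  by (simp add: color_def)

lemmas eig_intros = eig_add eig_diff eig_mult eig_1 eig_zeta eig_t eig_T eig_e eig_corr
lemmas closed_intros = add_closed diff_closed mult_closed one_closed elements_closed

lemma T_idem:
  assumes "a \<in> {1..n}" "b \<in> {1..n}"
  shows "T a b * T a b \<approx> T a b"
  by (rule diagonal_cong_eq[of a b b], (assumption | rule eig_intros closed_intros assms)+) auto

text \<open>Trichotomy: two colors are equal, ascending or descending, and exactly one case
  occurs.\<close>

lemma e_eq:
  assumes "a \<in> {1..n}" "b \<in> {1..n}"
  shows "e a b \<approx> 1 - T a b - T b a"
  by (rule diagonal_cong_eq[of a b b], (assumption | rule eig_intros closed_intros assms)+) auto

lemma T_t_commute:
  assumes "a \<in> {1..n}" "b \<in> {1..n}" "c \<in> {1..n}"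
  shows "t c * T a b \<approx> T a b * t c"
  by (rule diagonal_cong_eq[of a b c], (assumption | rule eig_intros closed_intros assms)+) (rule mult.commute)

text \<open>Each summand of \<open>T a b\<close> is a polynomial in \<open>t a\<close> times one in
  \<open>t b\<close>, so it moves past \<open>g\<close> factor by factor.\<close>

lemma T_intertwine:
  assumes "t a * g \<approx> g * t a'" "t b * g \<approx> g * t b'" "g \<in> C"
    and "a \<in> {1..n}" "b \<in> {1..n}" "a' \<in> {1..n}" "b' \<in> {1..n}"
  shows "T a b * g \<approx> g * T a' b'"
  unfolding ascending_def
  by (intro intertwine_sum intertwine_mult intertwine_proj assms p_closed t_closed)

lemma T_commute:
  assumes "a \<in> {1..n}" "b \<in> {1..n}" "c \<in> {1..n}" "d \<in> {1..n}"
  shows "T c d * T a b \<approx> T a b * T c d"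
  by (intro T_intertwine T_t_commute T_closed assms)

text \<open>On colors u < v all these elements act as q - q^-1 times \<xi>^v - \<xi>^u, and
  otherwise as 0. The two arrangements serve the two mixed relations with a correction term.\<close>

lemma corr_eq:
  assumes "a \<in> {1..n}" "b \<in> {1..n}"
  shows "corr a b \<approx> \<zeta> * (T a b * t b) - \<zeta> * (t a * T a b)"
    and "corr a b \<approx> \<zeta> * (t b * T a b) - \<zeta> * (T a b * t a)"
  by (rule diagonal_cong_eq[of a b b], (assumption | rule eig_intros closed_intros assms)+,
      auto simp: of_complex_simps algebra_simps)+

text \<open>The terms in \<open>T a b\<close> produce exactly the correction. A congruence of
  differences, here and below, makes each relation equivalent to its counterpart, so one computation
  serves both algebras.\<close>

lemma mixed_relation_right:
  assumes "a \<in> {1..n}" "b \<in> {1..n}" "g \<in> C"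
  shows "(g + \<zeta> * T a b) * t b - (t a * (g + \<zeta> * T a b) + corr a b) \<approx> g * t b - t a * g"
proof -
  have "(g + \<zeta> * T a b) * t b - (t a * (g + \<zeta> * T a b) + corr a b)
      = (g * t b - t a * g) + (\<zeta> * (T a b * t b) - \<zeta> * (t a * T a b) - corr a b)"
    by (simp add: algebra_simps zeta_left_commute[of "t a"])
  also have "\<dots> \<approx> (g * t b - t a * g) + (corr a b - corr a b)"
    using assms by (intro cong_add cong_diff[OF cong_sym[OF corr_eq(1)]] cong_refl closed_intros)
  finally show ?thesis by simp
qed

lemma mixed_relation_left:
  assumes "a \<in> {1..n}" "b \<in> {1..n}" "g \<in> C"
  shows "(g + \<zeta> * T a b) * t a - (t b * (g + \<zeta> * T a b) - corr a b) \<approx> g * t a - t b * g"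
proof -
  have "(g + \<zeta> * T a b) * t a - (t b * (g + \<zeta> * T a b) - corr a b)
      = (g * t a - t b * g) - (\<zeta> * (t b * T a b) - \<zeta> * (T a b * t a) - corr a b)"
    by (simp add: algebra_simps zeta_left_commute[of "t b"])
  also have "\<dots> \<approx> (g * t a - t b * g) - (corr a b - corr a b)"
    using assms by (intro cong_diff[OF cong_refl cong_diff[OF cong_sym[OF corr_eq(2)]]] cong_refl closed_intros)
  finally show ?thesis by simp
qed

lemma mixed_relation_other:
  assumes "a \<in> {1..n}" "b \<in> {1..n}" "c \<in> {1..n}" "g \<in> C"
  shows "(g + \<zeta> * T a b) * t c - t c * (g + \<zeta> * T a b) \<approx> g * t c - t c * g"
proof -
  have "(g + \<zeta> * T a b) * t c - t c * (g + \<zeta> * T a b) = (g * t c - t c * g) + \<zeta> * (T a b * t c - t c * T a b)"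
    by (simp add: algebra_simps zeta_left_commute[of "t c"])
  also have "\<dots> \<approx> (g * t c - t c * g) + \<zeta> * (T a b * t c - T a b * t c)"
    using assms by (intro cong_add cong_mult_left cong_diff T_t_commute cong_refl closed_intros)
  finally show ?thesis by simp
qed

text \<open>The swap turns \<open>g * T a b\<close> into \<open>T b a * g\<close>. Idempotence of
  \<open>T a b\<close> cancels the terms in \<zeta>^2, and trichotomy collects the terms linear in
  \<zeta> into \<open>e a b * g\<close>.\<close>

lemma quadratic_relation:
  assumes ab: "a \<in> {1..n}" "b \<in> {1..n}" and g: "g \<in> C"
    and swap: "t a * g \<approx> g * t b" "t b * g \<approx> g * t a"
  defines "h \<equiv> g + \<zeta> * T a b"
  shows "(h - const qvar) * (h + const (inverse qvar)) \<approx> g ^ 2 - (1 + \<zeta> * e a b * g)"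
proof -
  note closed = closed_intros ab g
  have "const qvar * const (inverse qvar) = (1 :: 'g word \<Rightarrow>\<^sub>0 complex poly fract)"
    by (simp add: qvar_neq_0 flip: const_mult)
  then have "(h - const qvar) * (h + const (inverse qvar)) = h * h - \<zeta> * h - 1"
    by (simp add: hecke_param_def const_diff algebra_simps const_commute[of "inverse qvar"])
  also have "\<dots> = g * g + \<zeta> * (g * T a b) + \<zeta> * (T a b * g) + \<zeta> * (\<zeta> * (T a b * T a b)) - \<zeta> * h - 1"
    by (simp add: h_def algebra_simps zeta_left_commute[of g] zeta_left_commute[of "T a b"])
  also have "\<dots> \<approx> g * g + \<zeta> * (T b a * g) + \<zeta> * (T a b * g) + \<zeta> * (\<zeta> * T a b) - \<zeta> * h - 1"
    unfolding h_def
    by (intro cong_add cong_diff cong_mult_left cong_sym[OF T_intertwine] T_idem swap cong_refl closed)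
  also have "\<dots> = g * g - 1 - \<zeta> * ((1 - T a b - T b a) * g)"
    by (simp add: h_def algebra_simps)
  also have "\<dots> \<approx> g * g - 1 - \<zeta> * (e a b * g)"
    by (intro cong_diff cong_mult_left cong_mult_right cong_sym[OF e_eq] cong_refl closed)
  finally show ?thesis
    by (simp add: power2_eq_square algebra_simps)
qed

text \<open>Every term involving \<open>T\<close> is a commutator of \<open>T a b\<close> with
  \<open>g'\<close>, of \<open>T c d\<close> with \<open>g\<close>, or of the two; all of them
  vanish modulo the ideal.\<close>

lemma far_relation:
  assumes abcd: "a \<in> {1..n}" "b \<in> {1..n}" "c \<in> {1..n}" "d \<in> {1..n}" and g: "g \<in> C" "g' \<in> C"
    and "t c * g \<approx> g * t c" "t d * g \<approx> g * t d" "t a * g' \<approx> g' * t a" "t b * g' \<approx> g' * t b"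
  shows "(g + \<zeta> * T a b) * (g' + \<zeta> * T c d) - (g' + \<zeta> * T c d) * (g + \<zeta> * T a b) \<approx> g * g' - g' * g"
proof -
  note closed = closed_intros abcd g
  have 1: "T a b * g' \<approx> g' * T a b" and 2: "T c d * g \<approx> g * T c d"
    by (intro T_intertwine assms)+
  have 3: "T c d * T a b \<approx> T a b * T c d"
    by (intro T_commute abcd)
  have "(g + \<zeta> * T a b) * (g' + \<zeta> * T c d) - (g' + \<zeta> * T c d) * (g + \<zeta> * T a b) =
      g * g' - g' * g + \<zeta> * (T a b * g' - g' * T a b) - \<zeta> * (T c d * g - g * T c d)
      - \<zeta> * (\<zeta> * (T c d * T a b - T a b * T c d))"
    by (simp add: algebra_simps zeta_left_commute[of g] zeta_left_commute[of g']
        zeta_left_commute[of "T a b"] zeta_left_commute[of "T c d"])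
  also have "\<dots> \<approx> g * g' - g' * g + \<zeta> * (g' * T a b - g' * T a b) - \<zeta> * (g * T c d - g * T c d)
      - \<zeta> * (\<zeta> * (T a b * T c d - T a b * T c d))"
    by (intro cong_add cong_diff cong_mult_left[of \<zeta>] 1 2 3 cong_refl closed)
  finally show ?thesis by simp
qed

text \<open>In the application \<open>A\<close>, \<open>B\<close>, \<open>D\<close> are
  \<open>T a b\<close>, \<open>T b c\<close>, \<open>T a c\<close>, or the same with
  \<open>A\<close> and \<open>B\<close> exchanged. Up to the order of these commuting elements, the
  right-hand side is symmetric under exchanging \<open>(g, A)\<close> with \<open>(g', B)\<close>,
  which gives the braid relation.\<close>

lemma braid_expansion:
  assumes closed: "g \<in> C" "g' \<in> C" "A \<in> C" "B \<in> C" "D \<in> C" "R \<in> C" "E \<in> C"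
    and gB: "g * B \<approx> D * g" and gD: "g * D \<approx> B * g" and gA: "g * A \<approx> R * g" and g'A: "g' * A \<approx> D * g'"
    and gg: "g * g \<approx> 1 + \<zeta> * E * g"
    and ABD: "D * E + A * B + D * R \<approx> D * B" and ABA: "A * B * A \<approx> A * B"
  shows "(g + \<zeta> * A) * (g' + \<zeta> * B) * (g + \<zeta> * A) - g * g' * g \<approx>
    \<zeta> * (A * g' * g + D + B * g * g') + \<zeta> * (\<zeta> * (D * B * g + A * D * g')) + \<zeta> * (\<zeta> * (\<zeta> * (A * B)))"
proof -
  note intros = closed_intros closed
  \<comment> \<open>The only term in which a square of \<open>g\<close> arises. The quadratic
    relation adds a part with a further factor \<zeta>.\<close>
  have gBg: "g * B * g \<approx> D + \<zeta> * (D * E * g)"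
  proof -
    have "g * B * g \<approx> D * g * g"
      by (intro cong_mult_right gB intros)
    also have "D * g * g = D * (g * g)"
      by (simp add: mult.assoc)
    also have "\<dots> \<approx> D * (1 + \<zeta> * E * g)"
      by (intro cong_mult_left gg intros)
    also have "\<dots> = D + \<zeta> * (D * E * g)"
      by (simp add: algebra_simps zeta_left_commute[of D])
    finally show ?thesis .
  qed
  have gg'A: "g * g' * A \<approx> B * g * g'"
  proof -
    have "g * g' * A = g * (g' * A)"
      by (simp add: mult.assoc)
    also have "\<dots> \<approx> g * (D * g')"
      by (intro cong_mult_left g'A intros)
    also have "\<dots> = g * D * g'"
      by (simp add: mult.assoc)
    also have "\<dots> \<approx> B * g * g'"
      by (intro cong_mult_right gD intros)
    finally show ?thesis .
  qed
  have Ag'A: "A * g' * A \<approx> A * D * g'"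
    using cong_mult_left[OF \<open>A \<in> C\<close> g'A] by (simp add: mult.assoc)
  have gBA: "g * B * A \<approx> D * R * g"
  proof -
    have "g * B * A \<approx> D * g * A"
      by (intro cong_mult_right gB intros)
    also have "D * g * A = D * (g * A)"
      by (simp add: mult.assoc)
    also have "\<dots> \<approx> D * (R * g)"
      by (intro cong_mult_left gA intros)
    finally show ?thesis
      by (simp add: mult.assoc)
  qed
  have "(g + \<zeta> * A) * (g' + \<zeta> * B) * (g + \<zeta> * A) - g * g' * g =
      \<zeta> * (A * g' * g + g * B * g + g * g' * A) + \<zeta> * (\<zeta> * (A * B * g + A * g' * A + g * B * A))
      + \<zeta> * (\<zeta> * (\<zeta> * (A * B * A)))"
    by (simp add: algebra_simps zeta_left_commute[of g] zeta_left_commute[of g']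
        zeta_left_commute[of A] zeta_left_commute[of B])
  also have "\<dots> \<approx> \<zeta> * (A * g' * g + (D + \<zeta> * (D * E * g)) + B * g * g')
      + \<zeta> * (\<zeta> * (A * B * g + A * D * g' + D * R * g)) + \<zeta> * (\<zeta> * (\<zeta> * (A * B)))"
    by (intro cong_add cong_mult_left[of \<zeta>] gBg gg'A Ag'A gBA ABA cong_refl intros)
  \<comment> \<open>The extra part of \<open>g * B * g\<close> is now of second order in \<zeta>,
    which makes the coefficient of \<open>g\<close> the left side of \<open>ABD\<close>.\<close>
  also have "\<dots> = \<zeta> * (A * g' * g + D + B * g * g')
      + \<zeta> * (\<zeta> * ((D * E + A * B + D * R) * g + A * D * g')) + \<zeta> * (\<zeta> * (\<zeta> * (A * B)))"
    by (simp add: algebra_simps)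
  also have "\<dots> \<approx> \<zeta> * (A * g' * g + D + B * g * g')
      + \<zeta> * (\<zeta> * (D * B * g + A * D * g')) + \<zeta> * (\<zeta> * (\<zeta> * (A * B)))"
    by (intro cong_add cong_mult_left[of \<zeta>] cong_mult_right[of "D * E + A * B + D * R"] ABD cong_refl intros)
  finally show ?thesis .
qed

lemma braid_relation:
  assumes abc: "a \<in> {1..n}" "b \<in> {1..n}" "c \<in> {1..n}" and g: "g \<in> C" "g' \<in> C"
    and g_swap: "t a * g \<approx> g * t b" "t b * g \<approx> g * t a" "t c * g \<approx> g * t c"
    and g'_swap: "t b * g' \<approx> g' * t c" "t c * g' \<approx> g' * t b" "t a * g' \<approx> g' * t a"
    and gg: "g * g \<approx> 1 + \<zeta> * e a b * g" and g'g': "g' * g' \<approx> 1 + \<zeta> * e b c * g'"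
  defines "h \<equiv> g + \<zeta> * T a b" and "h' \<equiv> g' + \<zeta> * T b c"
  shows "h * h' * h - h' * h * h' \<approx> g * g' * g - g' * g * g'"
proof -
  note closed = closed_intros abc g
  have 1: "h * h' * h - g * g' * g \<approx> \<zeta> * (T a b * g' * g + T a c + T b c * g * g')
      + \<zeta> * (\<zeta> * (T a c * T b c * g + T a b * T a c * g')) + \<zeta> * (\<zeta> * (\<zeta> * (T a b * T b c)))"
    unfolding h_def h'_def
  proof (rule braid_expansion[where R = "T b a" and E = "e a b"])
    \<comment> \<open>For colors u, v, w of a, b, c, the condition that u < w and v < w splits into
      the cases u = v, u < v and v < u, one for each summand.\<close>
    show "T a c * e a b + T a b * T b c + T a c * T b a \<approx> T a c * T b c"
      by (rule diagonal_cong_eq[of a b c], (assumption | rule eig_intros closed)+) auto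
    show "T a b * T b c * T a b \<approx> T a b * T b c"
      by (rule diagonal_cong_eq[of a b c], (assumption | rule eig_intros closed)+) auto
  qed (intro cong_sym[OF T_intertwine] g_swap g'_swap gg closed)+
  \<comment> \<open>The same expansion with \<open>g\<close> and \<open>g'\<close> exchanged. The
    condition to be split is now u < v and u < w, according to the order of v and w.\<close>
  have 2: "h' * h * h' - g' * g * g' \<approx> \<zeta> * (T b c * g * g' + T a c + T a b * g' * g)
      + \<zeta> * (\<zeta> * (T a c * T a b * g' + T b c * T a c * g)) + \<zeta> * (\<zeta> * (\<zeta> * (T b c * T a b)))"
    unfolding h_def h'_def
  proof (rule braid_expansion[where R = "T c b" and E = "e b c"])
    show "T a c * e b c + T b c * T a b + T a c * T c b \<approx> T a c * T a b"
      by (rule diagonal_cong_eq[of a b c], (assumption | rule eig_intros closed)+) auto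
    show "T b c * T a b * T b c \<approx> T b c * T a b"
      by (rule diagonal_cong_eq[of a b c], (assumption | rule eig_intros closed)+) auto
  qed (intro cong_sym[OF T_intertwine] g_swap g'_swap g'g' closed)+
  note 2
  also have "\<zeta> * (T b c * g * g' + T a c + T a b * g' * g)
      + \<zeta> * (\<zeta> * (T a c * T a b * g' + T b c * T a c * g)) + \<zeta> * (\<zeta> * (\<zeta> * (T b c * T a b))) \<approx>
      \<zeta> * (T b c * g * g' + T a c + T a b * g' * g)
      + \<zeta> * (\<zeta> * (T a b * T a c * g' + T a c * T b c * g)) + \<zeta> * (\<zeta> * (\<zeta> * (T a b * T b c)))"
    by (intro cong_add cong_mult_left[of \<zeta>] cong_mult_right[of "T _ _ * T _ _"] T_commute cong_refl closed)
  also have "\<dots> = \<zeta> * (T a b * g' * g + T a c + T b c * g * g')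
      + \<zeta> * (\<zeta> * (T a c * T b c * g + T a b * T a c * g')) + \<zeta> * (\<zeta> * (\<zeta> * (T a b * T b c)))"
    by (simp add: add_ac)
  also note cong_sym[OF 1]
  finally have 3: "h' * h * h' - g' * g * g' \<approx> h * h' * h - g * g' * g" .
  have "h * h' * h - h' * h * h' = (h * h' * h - g * g' * g) - (h' * h * h' - g' * g * g') + (g * g' * g - g' * g * g')"
    by simp
  also have "\<dots> \<approx> (h * h' * h - g * g' * g) - (h * h' * h - g * g' * g) + (g * g' * g - g' * g * g')"
    unfolding h_def h'_def
    by (intro cong_add cong_diff[OF cong_refl 3[unfolded h_def h'_def]] cong_refl closed)
  finally show ?thesis by simp
qed

end


section \<open>Equivalence of the two sets of relations\<close>

context commuting_roots
begin

lemma cong_iff_cong: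
  assumes "f - g \<approx> f' - g'" "f \<in> C" "g \<in> C" "f' \<in> C" "g' \<in> C"
  shows "f \<approx> g \<longleftrightarrow> f' \<approx> g'"
proof -
  have "f - g \<approx> 0 \<longleftrightarrow> f' - g' \<approx> 0"
    using cong_trans[OF assms(1)] cong_trans[OF cong_sym[OF assms(1)]] by blast
  then show ?thesis
    using assms by (simp add: cong_iff_diff)
qed

end

text \<open>Instantiated twice: in the Yokonuma-Hecke algebra the \<open>g\<close> are generators
  and the \<open>h\<close> are substituted elements, in the Ariki-Koike algebra the roles are
  reversed.\<close>

locale change_of_generators = commuting_roots S G r n t I
  for S and G :: "'g set" and r n t I +
  fixes g h :: "nat \<Rightarrow> 'g word \<Rightarrow>\<^sub>0 complex poly fract"
  assumes g_closed: "i \<in> {1..<n} \<Longrightarrow> g i \<in> C"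
    and h_eq: "i \<in> {1..<n} \<Longrightarrow> h (i + 1) = g i + \<zeta> * T i (i + 1)"
begin

lemma index:
  assumes "i \<in> {1..<n}"
  shows "i \<in> {1..n}" "i + 1 \<in> {1..n}"
  using assms by auto

lemma h_closed: "i \<in> {1..<n} \<Longrightarrow> h (i + 1) \<in> C"
  unfolding h_eq by (intro add_closed g_closed mult_closed zeta_closed T_closed index)

definition permutes_t :: "nat \<Rightarrow> bool" where
  "permutes_t i \<longleftrightarrow> (\<forall>j\<in>{1..n}. t j * g i \<approx> g i * t (transpose i (i + 1) j))"

lemma permutes_tD:
  assumes "permutes_t i" "i \<in> {1..<n}"
  shows "t i * g i \<approx> g i * t (i + 1)" "t (i + 1) * g i \<approx> g i * t i"
    and "j \<in> {1..n} \<Longrightarrow> j \<noteq> i \<Longrightarrow> j \<noteq> i + 1 \<Longrightarrow> t j * g i \<approx> g i * t j"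
  using assms(1) index[OF assms(2)] unfolding permutes_t_def
  by (force simp: transpose_def)+

lemma mixed_iff:
  assumes i: "i \<in> {1..<n}"
  shows "h (i + 1) * t (i + 1) \<approx> t i * h (i + 1) + corr i (i + 1) \<longleftrightarrow> t i * g i \<approx> g i * t (i + 1)"
    and "h (i + 1) * t i \<approx> t (i + 1) * h (i + 1) - corr i (i + 1) \<longleftrightarrow> t (i + 1) * g i \<approx> g i * t i"
    and "l \<in> {1..n} \<Longrightarrow> h (i + 1) * t l \<approx> t l * h (i + 1) \<longleftrightarrow> t l * g i \<approx> g i * t l"
proof -
  note closed = closed_intros index[OF i] g_closed[OF i]
  have sym: "f \<approx> f' \<longleftrightarrow> f' \<approx> f" for f f'
    using cong_sym by blast
  show "h (i + 1) * t (i + 1) \<approx> t i * h (i + 1) + corr i (i + 1) \<longleftrightarrow> t i * g i \<approx> g i * t (i + 1)"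
    unfolding h_eq[OF i] sym[of "t i * g i"]
    by (intro cong_iff_cong mixed_relation_right closed)
  show "h (i + 1) * t i \<approx> t (i + 1) * h (i + 1) - corr i (i + 1) \<longleftrightarrow> t (i + 1) * g i \<approx> g i * t i"
    unfolding h_eq[OF i] sym[of "t (i + 1) * g i"]
    by (intro cong_iff_cong mixed_relation_left closed)
  show "h (i + 1) * t l \<approx> t l * h (i + 1) \<longleftrightarrow> t l * g i \<approx> g i * t l" if "l \<in> {1..n}"
    unfolding h_eq[OF i] sym[of "t l * g i"]
    by (intro cong_iff_cong mixed_relation_other closed that)
qed

text \<open>The three families of mixed relations cover the indices \<open>i + 1\<close>,
  \<open>i\<close> and those fixed by s_i.\<close>

lemma permutes_tI:
  assumes "i \<in> {1..<n}"
    and "h (i + 1) * t (i + 1) \<approx> t i * h (i + 1) + corr i (i + 1)"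
    and "h (i + 1) * t i \<approx> t (i + 1) * h (i + 1) - corr i (i + 1)"
    and "\<And>l. l \<in> {1..n} \<Longrightarrow> l \<noteq> i \<Longrightarrow> l \<noteq> i + 1 \<Longrightarrow> h (i + 1) * t l \<approx> t l * h (i + 1)"
  shows "permutes_t i"
  using assms(2-) mixed_iff[OF assms(1)] unfolding permutes_t_def by (auto simp: transpose_def)

lemma quadratic_iff:
  assumes i: "i \<in> {1..<n}" and "permutes_t i"
  shows "(h (i + 1) - const qvar) * (h (i + 1) + const (inverse qvar)) \<approx> 0 \<longleftrightarrow>
    g i ^ 2 \<approx> 1 + \<zeta> * e i (i + 1) * g i"
proof -
  note closed = closed_intros index[OF i] g_closed[OF i] const_closed q_closed zero_closed power_closed
  show ?thesis
    unfolding h_eq[OF i]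
    by (intro cong_iff_cong, unfold diff_zero)
       (intro quadratic_relation permutes_tD assms closed)+
qed

lemma far_iff:
  assumes i: "i \<in> {1..<n}" "permutes_t i" and j: "j \<in> {1..<n}" "permutes_t j"
    and "\<bar>int i - int j\<bar> > 1"
  shows "h (i + 1) * h (j + 1) \<approx> h (j + 1) * h (i + 1) \<longleftrightarrow> g i * g j \<approx> g j * g i"
proof -
  note closed = closed_intros index[OF i(1)] index[OF j(1)] g_closed[OF i(1)] g_closed[OF j(1)]
  have ne: "j \<noteq> i" "j \<noteq> i + 1" "j + 1 \<noteq> i" "j + 1 \<noteq> i + 1" "i \<noteq> j + 1"
    using assms(5) by auto
  show ?thesis
    unfolding h_eq[OF i(1)] h_eq[OF j(1)]
    by (intro cong_iff_cong far_relation permutes_tD i j closed ne ne[symmetric])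
qed

text \<open>The quadratic relations are hypotheses because expanding the braid words produces
  squares of the \<open>g\<close>; in either algebra they are established first.\<close>

lemma braid_iff:
  assumes i: "i \<in> {1..<n}" "i + 1 \<in> {1..<n}" "permutes_t i" "permutes_t (i + 1)"
    and "g i ^ 2 \<approx> 1 + \<zeta> * e i (i + 1) * g i"
    and "g (i + 1) ^ 2 \<approx> 1 + \<zeta> * e (i + 1) (i + 1 + 1) * g (i + 1)"
  shows "h (i + 1) * h (i + 1 + 1) * h (i + 1) \<approx> h (i + 1 + 1) * h (i + 1) * h (i + 1 + 1) \<longleftrightarrow>
    g i * g (i + 1) * g i \<approx> g (i + 1) * g i * g (i + 1)"
proof -
  note closed = closed_intros index[OF i(1)] index[OF i(2)] g_closed[OF i(1)] g_closed[OF i(2)]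
  show ?thesis
    unfolding h_eq[OF i(1)] h_eq[OF i(2)]
    by (intro cong_iff_cong braid_relation permutes_tD(1,2)[OF i(3,1)] permutes_tD(1,2)[OF i(4,2)]
        permutes_tD(3)[OF i(3,1)] permutes_tD(3)[OF i(4,2)] assms(5,6)[unfolded power2_eq_square] closed) auto
qed

end


section \<open>The isomorphism\<close>

lemma coeff_ring_carrier:
  "carrier (coeff_ring r) = generate_ring ring_of_type_algebra
     {qvar, inverse qvar, of_complex (xi r), of_complex (inverse (of_nat r)), of_complex (inverse (Delta0 r))}"
  by (simp add: coeff_ring_def)

lemma scalar_subring_coeff_ring: "scalar_subring (carrier (coeff_ring r))"
proof (rule scalar_subring.intro)
  interpret K: ring "ring_of_type_algebra :: complex poly fract ring"
    by (rule ring_from_type_algebra)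
  show "subring (carrier (coeff_ring r)) ring_of_type_algebra"
    unfolding coeff_ring_carrier by (rule K.generate_ring_is_subring) (simp add: ring_of_type_algebra_def)
qed

lemma torsion_elements_coeff_ring:
  assumes "r \<ge> 1" "\<And>a. a \<in> {1..n} \<Longrightarrow> t a \<in> carrier (free_algebra (carrier (coeff_ring r)) G)"
  shows "torsion_elements (carrier (coeff_ring r)) G r n t"
  unfolding torsion_elements_def torsion_elements_axioms_def
  using assms scalar_subring_coeff_ring by (auto simp: coeff_ring_carrier intro: generate_ring.incl)

lemma torsion_elements_yt:
  "r \<ge> 1 \<Longrightarrow> torsion_elements (carrier (coeff_ring r)) (yh_generators n) r n yt"
  by (intro torsion_elements_coeff_ring scalar_subring.gen_closed[OF scalar_subring_coeff_ring])
     (auto simp: yh_generators_def)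

lemma torsion_elements_ako:
  "r \<ge> 1 \<Longrightarrow> torsion_elements (carrier (coeff_ring r)) (ak_generators n) r n ako"
  by (intro torsion_elements_coeff_ring scalar_subring.gen_closed[OF scalar_subring_coeff_ring])
     (auto simp: ak_generators_def)

section \<open>The defining relations in a common indexing\<close>

lemma yh_relations_intros:
  "i \<in> {1..n} \<Longrightarrow> (yt i ^ r, 1) \<in> yh_relations r n"
  "i \<in> {1..n} \<Longrightarrow> j \<in> {1..n} \<Longrightarrow> (yt i * yt j, yt j * yt i) \<in> yh_relations r n"
  "i \<in> {1..<n} \<Longrightarrow> j \<in> {1..n} \<Longrightarrow> (yt j * yg i, yg i * yt (transpose i (i + 1) j)) \<in> yh_relations r n"
  "i \<in> {1..<n} \<Longrightarrow> j \<in> {1..<n} \<Longrightarrow> \<bar>int i - int j\<bar> > 1 \<Longrightarrow> (yg i * yg j, yg j * yg i) \<in> yh_relations r n"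
  "i \<in> {1..<n} \<Longrightarrow> i + 1 \<in> {1..<n} \<Longrightarrow>
    (yg i * yg (i + 1) * yg i, yg (i + 1) * yg i * yg (i + 1)) \<in> yh_relations r n"
  "i \<in> {1..<n} \<Longrightarrow> (yg i ^ 2, 1 + hecke_param * coinciding r yt i (i + 1) * yg i) \<in> yh_relations r n"
  unfolding yh_relations_def ye_eq hecke_param_def by blast+

lemma yh_relations_cases:
  assumes "(u, v) \<in> yh_relations r n"
  obtains i where "i \<in> {1..n}" "u = yt i ^ r" "v = 1"
  | i j where "i \<in> {1..n}" "j \<in> {1..n}" "u = yt i * yt j" "v = yt j * yt i"
  | i j where "i \<in> {1..<n}" "j \<in> {1..n}" "u = yt j * yg i" "v = yg i * yt (transpose i (i + 1) j)"
  | i j where "i \<in> {1..<n}" "j \<in> {1..<n}" "\<bar>int i - int j\<bar> > 1" "u = yg i * yg j" "v = yg j * yg i"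
  | i where "i \<in> {1..<n}" "i + 1 \<in> {1..<n}"
      "u = yg i * yg (i + 1) * yg i" "v = yg (i + 1) * yg i * yg (i + 1)"
  | i where "i \<in> {1..<n}" "u = yg i ^ 2" "v = 1 + hecke_param * coinciding r yt i (i + 1) * yg i"
  using assms unfolding yh_relations_def ye_eq hecke_param_def by blast

text \<open>The \<open>h\<^sub>j\<close> are numbered as \<open>h\<^sub>i\<^sub>+\<^sub>1\<close> with \<open>1 \<le> i < n\<close>, to match the \<open>g\<^sub>i\<close>.\<close>

lemma ak_relations_intros:
  "i \<in> {1..<n} \<Longrightarrow>
    ((akh (i + 1) - const qvar) * (akh (i + 1) + const (inverse qvar)), 0) \<in> ak_relations r n"
  "i \<in> {1..<n} \<Longrightarrow> j \<in> {1..<n} \<Longrightarrow> \<bar>int i - int j\<bar> > 1 \<Longrightarrow>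
    (akh (i + 1) * akh (j + 1), akh (j + 1) * akh (i + 1)) \<in> ak_relations r n"
  "i \<in> {1..<n} \<Longrightarrow> i + 1 \<in> {1..<n} \<Longrightarrow>
    (akh (i + 1) * akh (i + 1 + 1) * akh (i + 1), akh (i + 1 + 1) * akh (i + 1) * akh (i + 1 + 1)) \<in> ak_relations r n"
  "i \<in> {1..n} \<Longrightarrow> (\<Prod>k\<leftarrow>[1..<r + 1]. ako i - cst (xi r ^ k), 0) \<in> ak_relations r n"
  "i \<in> {1..n} \<Longrightarrow> j \<in> {1..n} \<Longrightarrow> (ako i * ako j, ako j * ako i) \<in> ak_relations r n"
  "i \<in> {1..<n} \<Longrightarrow>
    (akh (i + 1) * ako (i + 1), ako i * akh (i + 1) + correction r ako i (i + 1)) \<in> ak_relations r n"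
  "i \<in> {1..<n} \<Longrightarrow>
    (akh (i + 1) * ako i, ako (i + 1) * akh (i + 1) - correction r ako i (i + 1)) \<in> ak_relations r n"
  "i \<in> {1..<n} \<Longrightarrow> l \<in> {1..n} \<Longrightarrow> l \<noteq> i + 1 \<Longrightarrow> l \<noteq> i \<Longrightarrow>
    (akh (i + 1) * ako l, ako l * akh (i + 1)) \<in> ak_relations r n"
proof -
  have
    "i \<in> {2..n} \<Longrightarrow> ((akh i - const qvar) * (akh i + const (inverse qvar)), 0) \<in> ak_relations r n"
    "i \<in> {2..n} \<Longrightarrow> j \<in> {2..n} \<Longrightarrow> \<bar>int i - int j\<bar> > 1 \<Longrightarrow> (akh i * akh j, akh j * akh i) \<in> ak_relations r n"
    "2 \<le> i \<Longrightarrow> i + 1 \<le> n \<Longrightarrow>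
      (akh i * akh (i + 1) * akh i, akh (i + 1) * akh i * akh (i + 1)) \<in> ak_relations r n"
    "i \<in> {2..n} \<Longrightarrow> (akh i * ako i, ako (i - 1) * akh i + correction r ako (i - 1) i) \<in> ak_relations r n"
    "i \<in> {2..n} \<Longrightarrow> (akh i * ako (i - 1), ako i * akh i - correction r ako (i - 1) i) \<in> ak_relations r n"
    "i \<in> {2..n} \<Longrightarrow> l \<in> {1..n} \<Longrightarrow> l \<noteq> i \<Longrightarrow> l \<noteq> i - 1 \<Longrightarrow> (akh i * ako l, ako l * akh i) \<in> ak_relations r n"
    for i j l
    unfolding ak_relations_def ak_correction_eq_correction by blast+
  note * = this(1)[of "i + 1"] this(2)[of "i + 1" "j + 1"] this(3)[of "i + 1"] this(4,5)[of "i + 1"]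
    this(6)[of "i + 1" l]
  show "i \<in> {1..n} \<Longrightarrow> (\<Prod>k\<leftarrow>[1..<r + 1]. ako i - cst (xi r ^ k), 0) \<in> ak_relations r n"
    "i \<in> {1..n} \<Longrightarrow> j \<in> {1..n} \<Longrightarrow> (ako i * ako j, ako j * ako i) \<in> ak_relations r n"
    unfolding ak_relations_def by blast+

  show "i \<in> {1..<n} \<Longrightarrow>
    ((akh (i + 1) - const qvar) * (akh (i + 1) + const (inverse qvar)), 0) \<in> ak_relations r n"
    "i \<in> {1..<n} \<Longrightarrow> j \<in> {1..<n} \<Longrightarrow> \<bar>int i - int j\<bar> > 1 \<Longrightarrow>
    (akh (i + 1) * akh (j + 1), akh (j + 1) * akh (i + 1)) \<in> ak_relations r n"
    "i \<in> {1..<n} \<Longrightarrow> i + 1 \<in> {1..<n} \<Longrightarrow>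
    (akh (i + 1) * akh (i + 1 + 1) * akh (i + 1), akh (i + 1 + 1) * akh (i + 1) * akh (i + 1 + 1)) \<in> ak_relations r n"
    "i \<in> {1..<n} \<Longrightarrow>
    (akh (i + 1) * ako (i + 1), ako i * akh (i + 1) + correction r ako i (i + 1)) \<in> ak_relations r n"
    "i \<in> {1..<n} \<Longrightarrow>
    (akh (i + 1) * ako i, ako (i + 1) * akh (i + 1) - correction r ako i (i + 1)) \<in> ak_relations r n"
    "i \<in> {1..<n} \<Longrightarrow> l \<in> {1..n} \<Longrightarrow> l \<noteq> i + 1 \<Longrightarrow> l \<noteq> i \<Longrightarrow>
    (akh (i + 1) * ako l, ako l * akh (i + 1)) \<in> ak_relations r n"
    using * by simp_all
qed

lemma ak_relations_cases:
  assumes "(u, v) \<in> ak_relations r n"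
  obtains i where "i \<in> {1..<n}"
      "u = (akh (i + 1) - const qvar) * (akh (i + 1) + const (inverse qvar))" "v = 0"
  | i j where "i \<in> {1..<n}" "j \<in> {1..<n}" "\<bar>int i - int j\<bar> > 1"
      "u = akh (i + 1) * akh (j + 1)" "v = akh (j + 1) * akh (i + 1)"
  | i where "i \<in> {1..<n}" "i + 1 \<in> {1..<n}"
      "u = akh (i + 1) * akh (i + 1 + 1) * akh (i + 1)" "v = akh (i + 1 + 1) * akh (i + 1) * akh (i + 1 + 1)"
  | i where "i \<in> {1..n}" "u = (\<Prod>k\<leftarrow>[1..<r + 1]. ako i - cst (xi r ^ k))" "v = 0"
  | i j where "i \<in> {1..n}" "j \<in> {1..n}" "u = ako i * ako j" "v = ako j * ako i"
  | i where "i \<in> {1..<n}"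
      "u = akh (i + 1) * ako (i + 1)" "v = ako i * akh (i + 1) + correction r ako i (i + 1)"
  | i where "i \<in> {1..<n}"
      "u = akh (i + 1) * ako i" "v = ako (i + 1) * akh (i + 1) - correction r ako i (i + 1)"
  | i l where "i \<in> {1..<n}" "l \<in> {1..n}" "l \<noteq> i + 1" "l \<noteq> i"
      "u = akh (i + 1) * ako l" "v = ako l * akh (i + 1)"
proof -
  \<comment> \<open>Ariki-Koike indices of h start at 2, so the natural-number predecessor is
    exact.\<close>
  have shift: "j - 1 \<in> {1..<n}" "j - 1 + 1 = j" if "j \<in> {2..n}" for j
    using that by auto
  from assms consider
    i where "i \<in> {2..n}" "u = (akh i - const qvar) * (akh i + const (inverse qvar))" "v = 0"
  | i j where "i \<in> {2..n}" "j \<in> {2..n}" "\<bar>int i - int j\<bar> > 1" "u = akh i * akh j" "v = akh j * akh i"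
  | i where "2 \<le> i" "i + 1 \<le> n" "u = akh i * akh (i + 1) * akh i" "v = akh (i + 1) * akh i * akh (i + 1)"
  | i where "i \<in> {1..n}" "u = (\<Prod>k\<leftarrow>[1..<r + 1]. ako i - cst (xi r ^ k))" "v = 0"
  | i j where "i \<in> {1..n}" "j \<in> {1..n}" "u = ako i * ako j" "v = ako j * ako i"
  | j where "j \<in> {2..n}" "u = akh j * ako j" "v = ako (j - 1) * akh j + correction r ako (j - 1) j"
  | j where "j \<in> {2..n}" "u = akh j * ako (j - 1)" "v = ako j * akh j - correction r ako (j - 1) j"
  | j l where "j \<in> {2..n}" "l \<in> {1..n}" "l \<noteq> j" "l \<noteq> j - 1" "u = akh j * ako l" "v = ako l * akh j"
    unfolding ak_relations_def ak_correction_eq_correction by blast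
  then show thesis
  proof cases
    case (1 i)
    then show ?thesis using that(1)[of "i - 1"] shift[of i] by simp
  next
    case (2 i j)
    moreover have "\<bar>int (i - 1) - int (j - 1)\<bar> > 1"
      using 2 by auto
    ultimately show ?thesis using that(2)[of "i - 1" "j - 1"] shift[of i] shift[of j] by simp
  next
    case (3 i)
    moreover have "i - 1 \<in> {1..<n}" "i - 1 + 1 = i" "i \<in> {1..<n}"
      using 3 by auto
    ultimately show ?thesis using that(3)[of "i - 1"] by simp
  next
    case (6 j)
    then show ?thesis using that(6)[of "j - 1"] shift[of j] by simp
  next
    case (7 j)
    then show ?thesis using that(7)[of "j - 1"] shift[of j] by simp
  next
    case (8 j l)
    then show ?thesis using that(8)[of "j - 1" l] shift[of j] by simp
  qed (use that(4,5) in blast)+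
qed

text \<open>The subtracted term contains only \<omega>'s, which \<open>ak_to_yh\<close> sends to
  t's, so it cancels against the term added there, already in the free algebra.\<close>

fun yh_to_ak :: "nat \<Rightarrow> yh_generator \<Rightarrow> ak_free" where
  "yh_to_ak r (Gen_g i) = akh (i + 1) - hecke_param * ascending r ako i (i + 1)"
| "yh_to_ak r (Gen_t i) = ako i"

fun ak_to_yh :: "nat \<Rightarrow> ak_generator \<Rightarrow> yh_free" where
  "ak_to_yh r (Gen_h j) = yg (j - 1) + hecke_param * ascending r yt (j - 1) j"
| "ak_to_yh r (Gen_omega i) = yt i"

section \<open>Both substitutions respect the relations\<close>

locale yokonuma_ariki =
  fixes r n :: nat
  assumes r_ge_1: "r \<ge> 1"
begin

abbreviation "S \<equiv> carrier (coeff_ring r)"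

sublocale scalar_subring S
  by (rule scalar_subring_coeff_ring)

sublocale yh: torsion_elements S "yh_generators n" r n yt
  by (rule torsion_elements_yt[OF r_ge_1])

sublocale ak: torsion_elements S "ak_generators n" r n ako
  by (rule torsion_elements_ako[OF r_ge_1])

lemma yg_closed: "i \<in> {1..<n} \<Longrightarrow> yg i \<in> free_carrier (yh_generators n)"
  by (intro gen_closed) (auto simp: yh_generators_def)

lemma akh_closed: "i \<in> {1..<n} \<Longrightarrow> akh (i + 1) \<in> free_carrier (ak_generators n)"
  by (intro gen_closed) (auto simp: ak_generators_def)

lemma yh_relations_closed:
  "yh_relations r n \<subseteq> free_carrier (yh_generators n) \<times> free_carrier (yh_generators n)"
proof clarify
  fix u v assume "(u, v) \<in> yh_relations r n"
  then show "u \<in> free_carrier (yh_generators n) \<and> v \<in> free_carrier (yh_generators n)"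
    by (cases rule: yh_relations_cases)
       (auto intro!: mult_closed add_closed power_closed one_closed yh.elements_closed yg_closed
         simp: transpose_def)
qed

lemma ak_relations_closed:
  "ak_relations r n \<subseteq> free_carrier (ak_generators n) \<times> free_carrier (ak_generators n)"
proof clarify
  fix u v assume "(u, v) \<in> ak_relations r n"
  then show "u \<in> free_carrier (ak_generators n) \<and> v \<in> free_carrier (ak_generators n)"
    by (cases rule: ak_relations_cases)
       (auto intro!: one_closed mult_closed add_closed diff_closed prod_list_closed const_closed zero_closed
         ak.elements_closed akh_closed[unfolded Suc_eq_plus1[symmetric]] ak.q_closed ak.xi_power_closed)
qed

abbreviation "yh_ideal \<equiv> relation_ideal (yh_generators n) (yh_relations r n)"
abbreviation "ak_ideal \<equiv> relation_ideal (ak_generators n) (ak_relations r n)"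

sublocale yh: free_algebra_ideal S "yh_generators n" yh_ideal
  by (intro free_algebra_ideal.intro free_algebra_ideal_axioms.intro scalar_subring_axioms
      ideal_relation_ideal yh_relations_closed)

sublocale ak: free_algebra_ideal S "ak_generators n" ak_ideal
  by (intro free_algebra_ideal.intro free_algebra_ideal_axioms.intro scalar_subring_axioms
      ideal_relation_ideal ak_relations_closed)

lemma yh_relation: "(u, v) \<in> yh_relations r n \<Longrightarrow> yh.cong u v"
  using relation_in_ideal[OF yh_relations_closed] yh_relations_closed by (auto simp: yh.cong_def)

lemma ak_relation: "(u, v) \<in> ak_relations r n \<Longrightarrow> ak.cong u v"
  using relation_in_ideal[OF ak_relations_closed] ak_relations_closed by (auto simp: ak.cong_def)

lemma ak_power_r:
  assumes "a \<in> {1..n}"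
  shows "ak.cong (ako a ^ r) 1"
  using ak_relation[OF ak_relations_intros(4)[OF assms]] assms
  by (simp only: prod_linear_factors[OF r_ge_1])
     (simp add: ak.cong_iff_diff power_closed one_closed ak.t_closed del: atLeastAtMost_iff)

sublocale yh: change_of_generators S "yh_generators n" r n yt yh_ideal yg
  "\<lambda>j. subst (ak_to_yh r) (akh j)"
  by unfold_locales
     (auto intro!: yh_relation yh_relations_intros yg_closed[unfolded atLeastLessThan_iff])

text \<open>Here \<open>g\<close> is obtained by solving for it in terms of the generators
  \<open>akh\<close>, so \<open>h_eq\<close> holds by cancellation.\<close>

sublocale ak: change_of_generators S "ak_generators n" r n ako ak_ideal
  "\<lambda>i. subst (yh_to_ak r) (yg i)" akh
  by unfold_locales
     (auto intro!: ak_relation ak_relations_intros ak_power_r diff_closed mult_closed ak.elements_closed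
       akh_closed[unfolded Suc_eq_plus1[symmetric]])

lemma yh_permutes_t: "i \<in> {1..<n} \<Longrightarrow> yh.permutes_t i"
  unfolding yh.permutes_t_def by (intro ballI yh_relation yh_relations_intros)

lemma ak_permutes_t: "i \<in> {1..<n} \<Longrightarrow> ak.permutes_t i"
  by (intro ak.permutes_tI ak_relation ak_relations_intros)

lemma subst_yt: "subst (yh_to_ak r) (yt i) = ako i"
  by simp

lemma subst_ako: "subst (ak_to_yh r) (ako i) = yt i"
  by simp

text \<open>The relations involving h become left sides of the equivalences in \<open>yh\<close>,
  whose right sides are Yokonuma-Hecke relations. Those among the \<omega>'s carry over
  directly.\<close>

lemma subst_ak_relation:
  assumes "(u, v) \<in> ak_relations r n"
  shows "yh.cong (subst (ak_to_yh r) u) (subst (ak_to_yh r) v)"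
  using assms
proof (cases rule: ak_relations_cases)
  case (1 i)
  then show ?thesis
    using yh.quadratic_iff[OF 1(1) yh_permutes_t[OF 1(1)]] yh_relation[OF yh_relations_intros(6)[OF 1(1)]]
    by (simp only: subst_simps subst_const subst_0)
next
  case (2 i j)
  then show ?thesis
    using yh.far_iff[OF 2(1) yh_permutes_t[OF 2(1)] 2(2) yh_permutes_t[OF 2(2)] 2(3)]
      yh_relation[OF yh_relations_intros(4)[OF 2(1-3)]]
    by (simp only: subst_simps)
next
  case (3 i)
  then show ?thesis
    using yh.braid_iff[OF 3(1,2) yh_permutes_t[OF 3(1)] yh_permutes_t[OF 3(2)]]
      yh_relation[OF yh_relations_intros(6)[OF 3(1)]] yh_relation[OF yh_relations_intros(6)[OF 3(2)]]
      yh_relation[OF yh_relations_intros(5)[OF 3(1,2)]]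
    by (simp only: subst_simps)
next
  case (4 i)
  then show ?thesis
    using yh.cong_iff_diff[of "yt i ^ r" 1] yh_relation[OF yh_relations_intros(1)[OF 4(1)]]
    by (simp only: prod_linear_factors[OF r_ge_1] subst_simps subst_ako subst_1 subst_0
        power_closed one_closed yh.t_closed)
next
  case (5 i j)
  then show ?thesis
    using yh_relation[OF yh_relations_intros(2)[OF 5(1,2)]]
    by (simp only: subst_simps subst_ako)
next
  case (6 i)
  then show ?thesis
    using yh.mixed_iff(1)[OF 6(1)] yh.permutes_tD(1)[OF yh_permutes_t 6(1)]
    by (simp only: subst_simps subst_ako subst_coloring)
next
  case (7 i)
  then show ?thesis
    using yh.mixed_iff(2)[OF 7(1)] yh.permutes_tD(2)[OF yh_permutes_t 7(1)]
    by (simp only: subst_simps subst_ako subst_coloring)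
next
  case (8 i l)
  then show ?thesis
    using yh.mixed_iff(3)[OF 8(1,2)] yh.permutes_tD(3)[OF yh_permutes_t 8(1,2,4,3)]
    by (simp only: subst_simps subst_ako)
qed

text \<open>Needed twice: for the quadratic relation itself and as a hypothesis of the braid
  equivalence.\<close>

lemma ak_quadratic:
  assumes "i \<in> {1..<n}"
  shows "ak.cong (subst (yh_to_ak r) (yg i) ^ 2)
    (1 + hecke_param * coinciding r ako i (i + 1) * subst (yh_to_ak r) (yg i))"
  using ak.quadratic_iff[OF assms ak_permutes_t[OF assms]] ak_relation[OF ak_relations_intros(1)[OF assms]]
  by blast

lemma subst_yh_relation:
  assumes "(u, v) \<in> yh_relations r n"
  shows "ak.cong (subst (yh_to_ak r) u) (subst (yh_to_ak r) v)"
  using assms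
proof (cases rule: yh_relations_cases)
  case (1 i)
  then show ?thesis
    using ak_power_r by (simp only: subst_simps subst_yt subst_1)
next
  case (2 i j)
  then show ?thesis
    using ak_relation[OF ak_relations_intros(5)[OF 2(1,2)]] by (simp only: subst_simps subst_yt)
next
  case (3 i j)
  then show ?thesis
    using ak_permutes_t[OF 3(1)] unfolding ak.permutes_t_def by (simp only: subst_simps subst_yt)
next
  case (4 i j)
  then show ?thesis
    using ak.far_iff[OF 4(1) ak_permutes_t[OF 4(1)] 4(2) ak_permutes_t[OF 4(2)] 4(3)]
      ak_relation[OF ak_relations_intros(2)[OF 4(1-3)]]
    by (simp only: subst_simps)
next
  case (5 i)
  then show ?thesis
    using ak.braid_iff[OF 5(1,2) ak_permutes_t[OF 5(1)] ak_permutes_t[OF 5(2)] ak_quadratic[OF 5(1)] ak_quadratic[OF 5(2)]]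
      ak_relation[OF ak_relations_intros(3)[OF 5(1,2)]]
    by (simp only: subst_simps)
next
  case (6 i)
  then show ?thesis
    using ak_quadratic[OF 6(1)] by (simp only: subst_simps subst_coloring subst_yt subst_1)
qed

lemma yokonuma_hecke_isomorphic:
  "algebra_isomorphic (coeff_ring r) (yokonuma_hecke r n) (modified_ariki_koike r n)"
  unfolding yokonuma_hecke_def modified_ariki_koike_def
proof (rule presented_algebra_isomorphic[where \<sigma> = "yh_to_ak r" and \<tau> = "ak_to_yh r"])
  show "yh_to_ak r x \<in> free_carrier (ak_generators n)" if "x \<in> yh_generators n" for x
    using that ak.g_closed ak.t_closed by (auto simp: yh_generators_def)
  show "ak_to_yh r x \<in> free_carrier (yh_generators n)" if "x \<in> ak_generators n" for x
  proof (cases x)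
    case (Gen_h j)
    then have "j - 1 \<in> {1..<n}" "j - 1 + 1 = j"
      using that by (auto simp: ak_generators_def)
    then show ?thesis
      using yh.h_closed[of "j - 1"] Gen_h by simp
  next
    case (Gen_omega i)
    then show ?thesis
      using that yh.t_closed[of i] by (auto simp: ak_generators_def)
  qed
  \<comment> \<open>Membership of \<open>x\<close> among the generators ensures
    \<open>j - 1 + 1 = j\<close> for \<open>Gen_h j\<close>.\<close>
  show "subst (yh_to_ak r) (ak_to_yh r x) = gen x" if "x \<in> ak_generators n" for x
    using that by (cases x) (auto simp: ak_generators_def subst_simps subst_coloring)
  show "subst (ak_to_yh r) (yh_to_ak r x) = gen x" if "x \<in> yh_generators n" for x
    by (cases x) (simp_all add: subst_simps subst_coloring)
  show "subst (yh_to_ak r) u - subst (yh_to_ak r) v \<in> ak_ideal" if "(u, v) \<in> yh_relations r n" for u v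
    using subst_yh_relation[OF that] by (simp add: ak.cong_def)
  show "subst (ak_to_yh r) u - subst (ak_to_yh r) v \<in> yh_ideal" if "(u, v) \<in> ak_relations r n" for u v
    using subst_ak_relation[OF that] by (simp add: yh.cong_def)
qed (simp, rule yh_relations_closed, rule ak_relations_closed)

end

theorem theorem13:
  fixes n r :: nat
  assumes "n \<ge> 1" and "r \<ge> 1"
  shows "algebra_isomorphic (coeff_ring r) (yokonuma_hecke r n) (modified_ariki_koike r n)"
  using assms(2) by (intro yokonuma_ariki.yokonuma_hecke_isomorphic yokonuma_ariki.intro)

end
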